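(* There is an integer $\sigma$ such that, for every $\varepsilon>0$, no algorithm solves every $n$-vertex instance of Max Cut that is given with a $(\sigma,4)$-hub of size $p$ in time $(2-\varepsilon)^p\cdot n^{\mathcal{O}(1)}$, unless the M3SH fails.
   Context: For a graph $G$, a set $Q\subseteq V(G)$ is a $(\sigma,\delta)$-hub if every connected component of $G-Q$ has at most $\sigma$ vertices and is adjacent to at most $\delta$ vertices of $Q$. Max Cut: given a graph $G$, find a partition of $V(G)$ into two parts maximizing the number of edges with endpoints in different parts. Max 3-Sat: given a CNF formula with at most three literals per clause, find an assignment violating the fewest clauses. M3SH: there is no $\epsilon>0$ such that every $n$-variable Max 3-Sat instance can be solved in time $(2-\epsilon)^n n^{\mathcal{O}(1)}$. *)

theory Defs
  imports Complex_Main "HOL-Library.Discrete_Functions" "HOL-Library.Landau_Symbols"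
begin

section \<open>Algorithms: random access machine programs under logarithmic cost\<close>

text \<open>
  A program works on registers and on arrays (memory banks with indirect addressing), all
  containing natural numbers of arbitrary size. The cost of an operation is the total bit length
  of the numbers it handles, so large numbers cannot be used to hide work. With this convention
  a running time of the form \<open>b\<^sup>n n\<^sup>O\<^sup>(\<^sup>1\<^sup>)\<close> does not depend on the details of the instruction set.
\<close>

type_synonym reg = nat
type_synonym arr = nat

datatype com =
    Skip
  | Const reg nat
  | Add reg reg reg
  | Sub reg reg reg
  | Load reg arr reg
  | Store arr reg reg
  | Seq com com
  | Cond reg com com
  | While reg com

record state =
  regs :: "reg \<Rightarrow> nat"
  arrs :: "arr \<Rightarrow> nat \<Rightarrow> nat"

definition set_reg :: "reg \<Rightarrow> nat \<Rightarrow> state \<Rightarrow> state" where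
  "set_reg x k s = s\<lparr>regs := (regs s)(x := k)\<rparr>"

definition set_arr :: "arr \<Rightarrow> nat \<Rightarrow> nat \<Rightarrow> state \<Rightarrow> state" where
  "set_arr a i k s = s\<lparr>arrs := (arrs s)(a := (arrs s a)(i := k))\<rparr>"

definition bitlen :: "nat \<Rightarrow> nat" where
  "bitlen k = Suc (floor_log k)"

text \<open>
  \<open>exec P s t s'\<close>: started in state \<open>s\<close>, program \<open>P\<close> halts in state \<open>s'\<close> after time \<open>t\<close>.
  Subtraction is truncated; tests check whether a register is nonzero.
\<close>

inductive exec :: "com \<Rightarrow> state \<Rightarrow> nat \<Rightarrow> state \<Rightarrow> bool" where
  Skip: "exec Skip s 1 s"
| Const: "exec (Const x k) s (bitlen k) (set_reg x k s)"
| Add: "exec (Add x y z) s (bitlen (regs s y) + bitlen (regs s z))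
          (set_reg x (regs s y + regs s z) s)"
| Sub: "exec (Sub x y z) s (bitlen (regs s y) + bitlen (regs s z))
          (set_reg x (regs s y - regs s z) s)"
| Load: "exec (Load x a y) s (bitlen (regs s y) + bitlen (arrs s a (regs s y)))
          (set_reg x (arrs s a (regs s y)) s)"
| Store: "exec (Store a x y) s (bitlen (regs s x) + bitlen (regs s y))
          (set_arr a (regs s x) (regs s y) s)"
| Seq: "exec P s t s' \<Longrightarrow> exec P' s' t' s'' \<Longrightarrow> exec (Seq P P') s (t + t') s''"
| Cond_True: "regs s x \<noteq> 0 \<Longrightarrow> exec P s t s' \<Longrightarrow> exec (Cond x P P') s (bitlen (regs s x) + t) s'"
| Cond_False: "regs s x = 0 \<Longrightarrow> exec P' s t s' \<Longrightarrow> exec (Cond x P P') s (bitlen (regs s x) + t) s'"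
| While_True: "regs s x \<noteq> 0 \<Longrightarrow> exec P s t s' \<Longrightarrow> exec (While x P) s' t' s'' \<Longrightarrow>
    exec (While x P) s (bitlen (regs s x) + t + t') s''"
| While_False: "regs s x = 0 \<Longrightarrow> exec (While x P) s (bitlen (regs s x)) s"

inductive_cases SkipE: "exec Skip s t s'"
inductive_cases ConstE: "exec (Const x k) s t s'"
inductive_cases AddE: "exec (Add x y z) s t s'"
inductive_cases SubE: "exec (Sub x y z) s t s'"
inductive_cases LoadE: "exec (Load x a y) s t s'"
inductive_cases StoreE: "exec (Store a x y) s t s'"
inductive_cases SeqE: "exec (Seq P P') s t s'"
inductive_cases CondE: "exec (Cond x P P') s t s'"
inductive_cases WhileE: "exec (While x P) s t s'"

lemma exec_deterministic:
  "exec P s t s' \<Longrightarrow> exec P s u s'' \<Longrightarrow> t = u \<and> s' = s''"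
proof (induction arbitrary: u s'' rule: exec.induct)
  case (Seq P s t s' P' t' s1)
  from Seq.prems show ?case by (rule SeqE) (metis Seq.IH)
next
  case (Cond_True s x P t s' P')
  from Cond_True.prems show ?case by (rule CondE) (use Cond_True.hyps in \<open>auto dest!: Cond_True.IH\<close>)
next
  case (Cond_False s x P' t s' P)
  from Cond_False.prems show ?case by (rule CondE) (use Cond_False.hyps in \<open>auto dest!: Cond_False.IH\<close>)
next
  case (While_True s x P t s' t' s1)
  from While_True.prems show ?case by (rule WhileE) (use While_True.hyps in \<open>auto dest!: While_True.IH\<close>)
next
  case (While_False s x P)
  from While_False.prems show ?case by (rule WhileE) (use While_False.hyps in auto)
qed (erule SkipE ConstE AddE SubE LoadE StoreE, simp)+

text \<open>The input word is in array 0 and its length in register 0; the output is read from array 1.\<close>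

definition input_state :: "nat list \<Rightarrow> state" where
  "input_state w = \<lparr>regs = (\<lambda>x. 0)(0 := length w),
     arrs = (\<lambda>a i. 0)(0 := (\<lambda>i. if i < length w then w ! i else 0))\<rparr>"

definition computes_within :: "com \<Rightarrow> nat list \<Rightarrow> real \<Rightarrow> ((nat \<Rightarrow> nat) \<Rightarrow> bool) \<Rightarrow> bool" where
  "computes_within P w T correct \<longleftrightarrow>
     (\<exists>t s. exec P (input_state w) t s \<and> real t \<le> T \<and> correct (arrs s 1))"

definition poly_bounded :: "(nat \<Rightarrow> nat) \<Rightarrow> bool" where
  "poly_bounded f \<longleftrightarrow> (\<exists>k. (\<lambda>n. real (f n)) \<in> O(\<lambda>n. real n ^ k))"


section \<open>Max 3-Sat\<close>

type_synonym literal = "nat \<times> bool"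
type_synonym clause = "literal set"

text \<open>
  The variables are \<open>0, \<dots>, n - 1\<close>; the literal \<open>(x, b)\<close> is true iff \<open>x\<close> has value \<open>b\<close>.
  A formula is a set of clauses. In particular clauses are not repeated, so that the input size
  is polynomial in \<open>n\<close>; with unlimited repetition no bound in terms of \<open>n\<close> alone would be possible.
\<close>

definition three_cnf :: "nat \<Rightarrow> clause set \<Rightarrow> bool" where
  "three_cnf n F \<longleftrightarrow> (\<forall>C\<in>F. finite C \<and> card C \<le> 3 \<and> fst ` C \<subseteq> {..<n})"

definition violated :: "clause set \<Rightarrow> (nat \<Rightarrow> bool) \<Rightarrow> clause set" where
  "violated F \<alpha> = {C \<in> F. \<forall>(x, b)\<in>C. \<alpha> x \<noteq> b}"

definition max_sat_optimal :: "clause set \<Rightarrow> (nat \<Rightarrow> bool) \<Rightarrow> bool" where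
  "max_sat_optimal F \<alpha> \<longleftrightarrow> (\<forall>\<beta>. card (violated F \<alpha>) \<le> card (violated F \<beta>))"

definition cnf_listing :: "literal list list \<Rightarrow> clause set \<Rightarrow> bool" where
  "cnf_listing cs F \<longleftrightarrow>
     (\<forall>c\<in>set cs. distinct c) \<and> distinct (map set cs) \<and> set (map set cs) = F"

definition encode_clause :: "literal list \<Rightarrow> nat list" where
  "encode_clause c = length c # concat (map (\<lambda>(x, b). [x, of_bool b]) c)"

definition encode_cnf :: "nat \<Rightarrow> literal list list \<Rightarrow> nat list" where
  "encode_cnf n cs = n # length cs # concat (map encode_clause cs)"

definition solves_max_3sat :: "com \<Rightarrow> (nat \<Rightarrow> real) \<Rightarrow> bool" where
  "solves_max_3sat P T \<longleftrightarrow>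
     (\<forall>n F cs. three_cnf n F \<and> cnf_listing cs F \<longrightarrow>
        computes_within P (encode_cnf n cs) (T n)
          (\<lambda>out. max_sat_optimal F (\<lambda>x. out x \<noteq> 0)))"

definition M3SH :: bool where
  "M3SH \<longleftrightarrow> \<not> (\<exists>\<epsilon>::real. \<epsilon> > 0 \<and>
     (\<exists>P f. poly_bounded f \<and> solves_max_3sat P (\<lambda>n. (2 - \<epsilon>) ^ n * real (f n))))"


section \<open>Graphs, hubs and Max Cut\<close>

definition simple_graph :: "'a set \<Rightarrow> 'a set set \<Rightarrow> bool" where
  "simple_graph V E \<longleftrightarrow> finite V \<and> (\<forall>e\<in>E. e \<subseteq> V \<and> card e = 2)"

definition components :: "'a set \<Rightarrow> 'a set set \<Rightarrow> 'a set set" where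
  "components V E = (\<lambda>v. {(x, y). x \<in> V \<and> y \<in> V \<and> {x, y} \<in> E}\<^sup>* `` {v}) ` V"

text \<open>
  Since \<^const>\<open>components\<close> only uses edges inside its first argument, \<open>components (V - Q) E\<close>
  are the components of the graph obtained by deleting \<open>Q\<close>.
\<close>

definition hub :: "nat \<Rightarrow> nat \<Rightarrow> 'a set \<Rightarrow> 'a set set \<Rightarrow> 'a set \<Rightarrow> bool" where
  "hub \<sigma> \<delta> V E Q \<longleftrightarrow> Q \<subseteq> V \<and>
     (\<forall>C\<in>components (V - Q) E. card C \<le> \<sigma> \<and> card {q \<in> Q. \<exists>v\<in>C. {q, v} \<in> E} \<le> \<delta>)"

definition cut_edges :: "'a set \<Rightarrow> 'a set set \<Rightarrow> 'a set \<Rightarrow> 'a set set" where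
  "cut_edges V E A = {e \<in> E. \<exists>u\<in>A. \<exists>v\<in>V - A. e = {u, v}}"

definition is_max_cut :: "'a set \<Rightarrow> 'a set set \<Rightarrow> 'a set \<Rightarrow> bool" where
  "is_max_cut V E A \<longleftrightarrow> A \<subseteq> V \<and>
     (\<forall>B. B \<subseteq> V \<longrightarrow> card (cut_edges V E B) \<le> card (cut_edges V E A))"

definition edge_listing :: "(nat \<times> nat) list \<Rightarrow> nat set set \<Rightarrow> bool" where
  "edge_listing es E \<longleftrightarrow>
     distinct (map (\<lambda>(u, v). {u, v}) es) \<and> set (map (\<lambda>(u, v). {u, v}) es) = E"

definition encode_graph_hub :: "nat \<Rightarrow> (nat \<times> nat) list \<Rightarrow> nat list \<Rightarrow> nat list" where
  "encode_graph_hub n es qs =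
     [n, length es, length qs] @ concat (map (\<lambda>(u, v). [u, v]) es) @ qs"

definition solves_max_cut_with_hub :: "nat \<Rightarrow> nat \<Rightarrow> com \<Rightarrow> (nat \<Rightarrow> nat \<Rightarrow> real) \<Rightarrow> bool" where
  "solves_max_cut_with_hub \<sigma> \<delta> P T \<longleftrightarrow>
     (\<forall>n E Q es qs. simple_graph {..<n} E \<and> hub \<sigma> \<delta> {..<n} E Q \<and>
        edge_listing es E \<and> distinct qs \<and> set qs = Q \<longrightarrow>
        computes_within P (encode_graph_hub n es qs) (T n (card Q))
          (\<lambda>out. is_max_cut {..<n} E {v. v < n \<and> out v \<noteq> 0}))"

end

theory Submission
  imports Defs
begin

text \<open>
  Take the variables and one reference vertex \<open>r\<close>, whose side means ``false'', as the hub. A clause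
  with at most three literals is falsified iff the values \<open>\<ell>\<^sub>1, \<ell>\<^sub>2, \<ell>\<^sub>3\<close> of its literals (padded by
  \<open>r\<close>) all agree with \<open>r\<close>. Its gadget is a \<open>K\<^sub>5\<close> on \<open>r\<close>, three ports \<open>p\<^sub>1, p\<^sub>2, p\<^sub>3\<close> and a free vertex;
  with the best choice of the free vertex this cuts 4 edges if all ports agree with \<open>r\<close> and 6 edges
  otherwise. Each port is linked to its variable by an edge or a path of length two, which gains one
  more cut edge if \<open>p\<^sub>i = \<ell>\<^sub>i\<close>. Hence a gadget contributes at most 12 edges, and at most 11 if the clause
  is falsified (either the \<open>K\<^sub>5\<close> or a link loses), and both values are attained. A maximum cut
  therefore yields an optimal assignment, every component outside the hub has at most 7
  vertices and 4 neighbours in the hub, and the hub has size \<open>n + 1\<close>.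

  The reduction is carried out by a random access machine in polynomially many steps. A step at most
  doubles the largest number, so bit lengths stay small and the logarithmic cost is polynomial too.
  The output of the Max Cut program may contain numbers as long as its running time, so
  decoding costs a polynomial factor times that running time.
\<close>

section \<open>Unit cost and logarithmic cost\<close>

lemma regs_set_reg [simp]: "regs (set_reg x k s) = (regs s)(x := k)"
  by (simp add: set_reg_def)

lemma arrs_set_reg [simp]: "arrs (set_reg x k s) = arrs s"
  by (simp add: set_reg_def)

lemma regs_set_arr [simp]: "regs (set_arr a i k s) = regs s"
  by (simp add: set_arr_def)

lemma arrs_set_arr [simp]: "arrs (set_arr a i k s) = (arrs s)(a := (arrs s a)(i := k))"
  by (simp add: set_arr_def)

text \<open>Because of the rule \<open>weaken\<close>, \<open>k\<close> is only an upper bound on the number of steps.\<close>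

inductive unit_exec :: "com \<Rightarrow> state \<Rightarrow> nat \<Rightarrow> state \<Rightarrow> bool" where
  Skip: "unit_exec Skip s 1 s"
| Const: "unit_exec (Const x k) s 1 (set_reg x k s)"
| Add: "unit_exec (Add x y z) s 1 (set_reg x (regs s y + regs s z) s)"
| Sub: "unit_exec (Sub x y z) s 1 (set_reg x (regs s y - regs s z) s)"
| Load: "unit_exec (Load x a y) s 1 (set_reg x (arrs s a (regs s y)) s)"
| Store: "unit_exec (Store a x y) s 1 (set_arr a (regs s x) (regs s y) s)"
| Seq: "unit_exec P s k s' \<Longrightarrow> unit_exec P' s' k' s'' \<Longrightarrow> unit_exec (Seq P P') s (k + k') s''"
| Cond: "unit_exec (if regs s x \<noteq> 0 then P else P') s k s' \<Longrightarrow> unit_exec (Cond x P P') s (Suc k) s'"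
| While_True: "regs s x \<noteq> 0 \<Longrightarrow> unit_exec (Seq P (While x P)) s k s' \<Longrightarrow>
    unit_exec (While x P) s (Suc k) s'"
| While_False: "regs s x = 0 \<Longrightarrow> unit_exec (While x P) s 1 s"
| weaken: "unit_exec P s k s' \<Longrightarrow> k \<le> k' \<Longrightarrow> unit_exec P s k' s'"

lemma one_le_bitlen: "1 \<le> bitlen k"
  by (simp add: bitlen_def)

lemma exec_time_pos: "exec P s t s' \<Longrightarrow> 1 \<le> t"
  by (induction rule: exec.induct) (auto simp: bitlen_def)

lemma exec_imp_unit_exec: "exec P s t s' \<Longrightarrow> unit_exec P s t s'"
proof (induction rule: exec.induct)
  case (While_True s x P t s' t' s'')
  then have "unit_exec (While x P) s (Suc (t + t')) s''"
    by (intro unit_exec.While_True unit_exec.Seq)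
  then show ?case
    using one_le_bitlen[of "regs s x"] by (elim unit_exec.weaken) simp
qed (auto intro: unit_exec.intros(1-10)[THEN unit_exec.weaken] simp: bitlen_def)

lemma exec_Cond:
  "exec (if regs s x \<noteq> 0 then P else P') s t s' \<Longrightarrow> exec (Cond x P P') s (bitlen (regs s x) + t) s'"
  by (metis exec.Cond_True exec.Cond_False)

lemma exec_While_unfold:
  "regs s x \<noteq> 0 \<Longrightarrow> exec (Seq P (While x P)) s t s' \<Longrightarrow> exec (While x P) s (bitlen (regs s x) + t) s'"
  by (erule SeqE) (simp add: exec.While_True add.assoc[symmetric])

definition bounded_state :: "nat \<Rightarrow> state \<Rightarrow> bool" where
  "bounded_state L s \<longleftrightarrow> (\<forall>x. regs s x < 2 ^ L) \<and> (\<forall>a i. arrs s a i < 2 ^ L)"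

primrec max_const :: "com \<Rightarrow> nat" where
  "max_const Skip = 0"
| "max_const (Const x k) = k"
| "max_const (Add x y z) = 0"
| "max_const (Sub x y z) = 0"
| "max_const (Load x a y) = 0"
| "max_const (Store a x y) = 0"
| "max_const (Seq P P') = max (max_const P) (max_const P')"
| "max_const (Cond x P P') = max (max_const P) (max_const P')"
| "max_const (While x P) = max_const P"

lemma bounded_state_regs: "bounded_state L s \<Longrightarrow> regs s x < 2 ^ L"
  and bounded_state_arrs: "bounded_state L s \<Longrightarrow> arrs s a i < 2 ^ L"
  by (simp_all add: bounded_state_def)

lemma bounded_state_mono: "bounded_state L s \<Longrightarrow> L \<le> L' \<Longrightarrow> bounded_state L' s"
  unfolding bounded_state_def by (meson less_le_trans one_le_numeral power_increasing)

lemma bounded_state_set_reg: "bounded_state L s \<Longrightarrow> k < 2 ^ L \<Longrightarrow> bounded_state L (set_reg x k s)"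
  by (simp add: bounded_state_def)

lemma bounded_state_set_arr: "bounded_state L s \<Longrightarrow> k < 2 ^ L \<Longrightarrow> bounded_state L (set_arr a i k s)"
  by (simp add: bounded_state_def)

lemma less_power_if_le: "(k::nat) \<le> L \<Longrightarrow> k < 2 ^ L"
  using less_exp[of L] by linarith

lemma bitlen_le: "k < 2 ^ L \<Longrightarrow> bitlen k \<le> Suc L"
  using monoD[OF floor_log_mono, of k "2 ^ L"] by (simp add: bitlen_def)

lemma bitlen_add_le: "j < 2 ^ L \<Longrightarrow> k < 2 ^ L \<Longrightarrow> L \<le> M \<Longrightarrow> bitlen j + bitlen k \<le> 2 * M + 2"
  using bitlen_le[of j L] bitlen_le[of k L] by simp

lemma bitlen_regs_le: "bounded_state L s \<Longrightarrow> L \<le> M \<Longrightarrow> bitlen (regs s x) \<le> 2 * M + 2"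
  using bitlen_le[OF bounded_state_regs, of L s x] by simp

lemma unit_exec_bounded_state:
  "unit_exec P s k s' \<Longrightarrow> max_const P \<le> L \<Longrightarrow> bounded_state L s \<Longrightarrow> bounded_state (L + k) s'"
proof (induction arbitrary: L rule: unit_exec.induct)
  case (Const x k s)
  then show ?case
    by (auto intro: bounded_state_mono[OF bounded_state_set_reg] less_power_if_le)
next
  case (Add x y z s)
  have "regs s y + regs s z < 2 ^ (L + 1)"
    using bounded_state_regs[OF Add.prems(2), of y] bounded_state_regs[OF Add.prems(2), of z] by simp
  then show ?case
    using bounded_state_mono[OF Add.prems(2)] by (intro bounded_state_set_reg) simp_all
next
  case (Seq P s k s' P' k' s'')
  then have "bounded_state (L + k + k') s''"
    by simp
  then show ?case
    by (simp add: ac_simps)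
next
  case (Cond s x P P' k s')
  then have "bounded_state (L + k) s'"
    by simp
  then show ?case
    by (rule bounded_state_mono) simp
next
  case (While_True s x P k s')
  then have "bounded_state (L + k) s'"
    by simp
  then show ?case
    by (rule bounded_state_mono) simp
next
  case (weaken P s k s' k')
  then show ?case
    by (meson bounded_state_mono add_left_mono)
qed (auto intro!: bounded_state_mono[OF bounded_state_set_reg] bounded_state_mono[OF bounded_state_set_arr]
    bounded_state_regs bounded_state_arrs less_imp_diff_less elim: bounded_state_mono)

lemma exec_bounded_time: "exec P s t s' \<Longrightarrow> t \<le> T \<Longrightarrow> \<exists>t\<le>T. exec P s t s'"
  by blast

lemma unit_exec_imp_exec:
  assumes "unit_exec P s k s'" "max_const P \<le> L" "bounded_state L s" "L + k \<le> M"
  shows "\<exists>t\<le>k * (2 * M + 2). exec P s t s'"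
  using assms
proof (induction arbitrary: L rule: unit_exec.induct)
  case (Const x k s)
  have "bitlen k \<le> 2 * M + 2"
    using bitlen_le[OF less_power_if_le[of k L]] Const.prems by simp
  then show ?case
    using exec.Const by (metis mult_1)
next
  case (Seq P s k s' P' k' s'')
  obtain t where t: "t \<le> k * (2 * M + 2)" "exec P s t s'"
    using Seq.IH(1)[of L] Seq.prems by auto
  have "bounded_state (L + k) s'"
    using unit_exec_bounded_state[OF Seq.hyps(1)] Seq.prems by simp
  then obtain t' where t': "t' \<le> k' * (2 * M + 2)" "exec P' s' t' s''"
    using Seq.IH(2)[of "L + k"] Seq.prems by auto
  show ?case
    using exec.Seq[OF t(2) t'(2)] t(1) t'(1)
    by (intro exI[of _ "t + t'"]) (simp add: add_mult_distrib)
next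
  case (Cond s x P P' k s')
  then obtain t where t: "t \<le> k * (2 * M + 2)" "exec (if regs s x \<noteq> 0 then P else P') s t s'"
    using Cond.IH[of L] by (cases "regs s x = 0") auto
  have "bitlen (regs s x) + t \<le> Suc k * (2 * M + 2)"
    using bitlen_regs_le[OF Cond.prems(2), of M x] Cond.prems(3) t(1) by simp
  then show ?case
    using exec_Cond[OF t(2)] by blast
next
  case (While_True s x P k s')
  then obtain t where t: "t \<le> k * (2 * M + 2)" "exec (Seq P (While x P)) s t s'"
    by fastforce
  have "bitlen (regs s x) + t \<le> Suc k * (2 * M + 2)"
    using bitlen_regs_le[OF While_True.prems(2), of M x] While_True.prems(3) t(1) by simp
  then show ?case
    using exec_While_unfold[OF While_True.hyps(1) t(2)] by blast
next
  case (weaken P s k s' k')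
  then have "L + k \<le> M"
    by simp
  then show ?case
    using weaken.IH weaken.prems mult_le_mono1[OF weaken.hyps(2), of "2 * M + 2"] by (meson le_trans)
qed (auto intro!: exec.intros(1-6,11)[THEN exec_bounded_time] bitlen_add_le bounded_state_regs
    bounded_state_arrs simp: bitlen_def simp del: One_nat_def add_2_eq_Suc')

section \<open>Loop-free programs and counting loops\<close>

primrec loop_free :: "com \<Rightarrow> bool" where
  "loop_free Skip \<longleftrightarrow> True"
| "loop_free (Const x k) \<longleftrightarrow> True"
| "loop_free (Add x y z) \<longleftrightarrow> True"
| "loop_free (Sub x y z) \<longleftrightarrow> True"
| "loop_free (Load x a y) \<longleftrightarrow> True"
| "loop_free (Store a x y) \<longleftrightarrow> True"
| "loop_free (Seq P P') \<longleftrightarrow> loop_free P \<and> loop_free P'"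
| "loop_free (Cond x P P') \<longleftrightarrow> loop_free P \<and> loop_free P'"
| "loop_free (While x P) \<longleftrightarrow> False"

text \<open>Only meaningful for loop-free programs: \<open>apply_com\<close> and \<open>step_bound\<close> skip loops.\<close>

primrec apply_com :: "com \<Rightarrow> state \<Rightarrow> state" where
  "apply_com Skip s = s"
| "apply_com (Const x k) s = set_reg x k s"
| "apply_com (Add x y z) s = set_reg x (regs s y + regs s z) s"
| "apply_com (Sub x y z) s = set_reg x (regs s y - regs s z) s"
| "apply_com (Load x a y) s = set_reg x (arrs s a (regs s y)) s"
| "apply_com (Store a x y) s = set_arr a (regs s x) (regs s y) s"
| "apply_com (Seq P P') s = apply_com P' (apply_com P s)"
| "apply_com (Cond x P P') s = (if regs s x \<noteq> 0 then apply_com P s else apply_com P' s)"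
| "apply_com (While x P) s = s"

primrec step_bound :: "com \<Rightarrow> nat" where
  "step_bound Skip = 1"
| "step_bound (Const x k) = 1"
| "step_bound (Add x y z) = 1"
| "step_bound (Sub x y z) = 1"
| "step_bound (Load x a y) = 1"
| "step_bound (Store a x y) = 1"
| "step_bound (Seq P P') = step_bound P + step_bound P'"
| "step_bound (Cond x P P') = Suc (max (step_bound P) (step_bound P'))"
| "step_bound (While x P) = 1"

primrec assigned_regs :: "com \<Rightarrow> reg set" where
  "assigned_regs Skip = {}"
| "assigned_regs (Const x k) = {x}"
| "assigned_regs (Add x y z) = {x}"
| "assigned_regs (Sub x y z) = {x}"
| "assigned_regs (Load x a y) = {x}"
| "assigned_regs (Store a x y) = {}"
| "assigned_regs (Seq P P') = assigned_regs P \<union> assigned_regs P'"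
| "assigned_regs (Cond x P P') = assigned_regs P \<union> assigned_regs P'"
| "assigned_regs (While x P) = assigned_regs P"

primrec assigned_arrs :: "com \<Rightarrow> arr set" where
  "assigned_arrs Skip = {}"
| "assigned_arrs (Const x k) = {}"
| "assigned_arrs (Add x y z) = {}"
| "assigned_arrs (Sub x y z) = {}"
| "assigned_arrs (Load x a y) = {}"
| "assigned_arrs (Store a x y) = {a}"
| "assigned_arrs (Seq P P') = assigned_arrs P \<union> assigned_arrs P'"
| "assigned_arrs (Cond x P P') = assigned_arrs P \<union> assigned_arrs P'"
| "assigned_arrs (While x P) = assigned_arrs P"

lemma regs_apply_com: "x \<notin> assigned_regs P \<Longrightarrow> regs (apply_com P s) x = regs s x"
  by (induction P arbitrary: s) auto

lemma arrs_apply_com: "a \<notin> assigned_arrs P \<Longrightarrow> arrs (apply_com P s) a = arrs s a"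
  by (induction P arbitrary: s) auto

lemma unit_exec_loop_free: "loop_free P \<Longrightarrow> unit_exec P s (step_bound P) (apply_com P s)"
proof (induction P arbitrary: s)
  case (Cond x P P')
  let ?Q = "if regs s x \<noteq> 0 then P else P'"
  have "unit_exec ?Q s (step_bound ?Q) (apply_com ?Q s)"
    using Cond by simp
  then have "unit_exec ?Q s (max (step_bound P) (step_bound P')) (apply_com ?Q s)"
    by (rule unit_exec.weaken) simp
  from unit_exec.Cond[OF this] show ?case
    by (auto split: if_splits)
qed (auto intro: unit_exec.intros(1-7)[unfolded One_nat_def])

lemma unit_exec_counting_loop:
  assumes "loop_free P" "I 0 s"
    and counter: "\<And>i s. I i s \<Longrightarrow> regs s x = m - i"
    and step: "\<And>i s. i < m \<Longrightarrow> I i s \<Longrightarrow> I (Suc i) (apply_com P s)"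
  obtains s' where "unit_exec (While x P) s (m * Suc (step_bound P) + 1) s'" "I m s'"
proof -
  have "\<exists>s'. unit_exec (While x P) s (j * Suc (step_bound P) + 1) s' \<and> I m s'"
    if "I i s" "i + j = m" for i j s
    using that
  proof (induction j arbitrary: i s)
    case 0
    then show ?case
      using counter[of i s] unit_exec.While_False[of s x P] by auto
  next
    case (Suc j)
    then have "I (Suc i) (apply_com P s)"
      by (intro step) auto
    then obtain s' where s': "unit_exec (While x P) (apply_com P s) (j * Suc (step_bound P) + 1) s'" "I m s'"
      using Suc.IH[of "Suc i"] Suc.prems(2) by auto
    have "regs s x \<noteq> 0"
      using counter[OF Suc.prems(1)] Suc.prems(2) by simp
    from unit_exec.While_True[OF this unit_exec.Seq[OF unit_exec_loop_free[OF assms(1)] s'(1)]]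
    show ?case
      using s'(2) by (auto simp: ac_simps)
  qed
  then show ?thesis
    using assms(2) that by (metis add_0)
qed

section \<open>Simulating a program on shifted registers\<close>

primrec shift :: "nat \<Rightarrow> com \<Rightarrow> com" where
  "shift d Skip = Skip"
| "shift d (Const x k) = Const (d + x) k"
| "shift d (Add x y z) = Add (d + x) (d + y) (d + z)"
| "shift d (Sub x y z) = Sub (d + x) (d + y) (d + z)"
| "shift d (Load x a y) = Load (d + x) (d + a) (d + y)"
| "shift d (Store a x y) = Store (d + a) (d + x) (d + y)"
| "shift d (Seq P P') = Seq (shift d P) (shift d P')"
| "shift d (Cond x P P') = Cond (d + x) (shift d P) (shift d P')"
| "shift d (While x P) = While (d + x) (shift d P)"

lemma max_const_shift [simp]: "max_const (shift d P) = max_const P"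
  by (induction P) auto

definition overlay :: "nat \<Rightarrow> state \<Rightarrow> state \<Rightarrow> state" where
  "overlay d S s = \<lparr>regs = (\<lambda>x. if x < d then regs S x else regs s (x - d)),
     arrs = (\<lambda>a. if a < d then arrs S a else arrs s (a - d))\<rparr>"

lemma regs_overlay: "regs (overlay d S s) x = (if x < d then regs S x else regs s (x - d))"
  by (simp add: overlay_def)

lemma arrs_overlay: "arrs (overlay d S s) a = (if a < d then arrs S a else arrs s (a - d))"
  by (simp add: overlay_def)

lemma set_reg_overlay: "set_reg (d + x) k (overlay d S s) = overlay d S (set_reg x k s)"
  by (auto simp: overlay_def set_reg_def fun_eq_iff)

lemma set_arr_overlay: "set_arr (d + a) i k (overlay d S s) = overlay d S (set_arr a i k s)"
  by (auto simp: overlay_def set_arr_def fun_eq_iff)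

lemma eq_overlayI:
  assumes "\<And>x. regs S (d + x) = regs s x" "\<And>a. arrs S (d + a) = arrs s a"
  shows "S = overlay d S s"
proof -
  have "regs S x = regs (overlay d S s) x" "arrs S x = arrs (overlay d S s) x" for x
    using assms(1)[of "x - d"] assms(2)[of "x - d"] by (cases "x < d"; simp add: overlay_def)+
  then show ?thesis
    by (intro state.equality) (simp_all add: fun_eq_iff)
qed

lemma exec_shift: "exec P s t s' \<Longrightarrow> exec (shift d P) (overlay d S s) t (overlay d S s')"
proof (induction rule: exec.induct)
  case (Const x k s)
  show ?case
    using exec.Const[of "d + x" k "overlay d S s"] by (simp add: set_reg_overlay)
next
  case (Add x y z s)
  show ?case
    using exec.Add[of "d + x" "d + y" "d + z" "overlay d S s"] by (simp add: set_reg_overlay regs_overlay)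
next
  case (Sub x y z s)
  show ?case
    using exec.Sub[of "d + x" "d + y" "d + z" "overlay d S s"] by (simp add: set_reg_overlay regs_overlay)
next
  case (Load x a y s)
  show ?case
    using exec.Load[of "d + x" "d + a" "d + y" "overlay d S s"]
    by (simp add: set_reg_overlay regs_overlay arrs_overlay)
next
  case (Store a x y s)
  show ?case
    using exec.Store[of "d + a" "d + x" "d + y" "overlay d S s"]
    by (simp add: set_arr_overlay regs_overlay)
next
  case (Cond_True s x P t s' P')
  then show ?case
    using exec.Cond_True[of "overlay d S s" "d + x"] by (simp add: regs_overlay)
next
  case (Cond_False s x P' t s' P)
  then show ?case
    using exec.Cond_False[of "overlay d S s" "d + x"] by (simp add: regs_overlay)
next
  case (While_True s x P t s' t' s'')
  then show ?case
    using exec.While_True[of "overlay d S s" "d + x"] by (simp add: regs_overlay)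
next
  case (While_False s x P)
  then show ?case
    using exec.While_False[of "overlay d S s" "d + x"] by (simp add: regs_overlay)
qed (simp_all add: exec.Skip exec.Seq del: One_nat_def)

text \<open>
  The simulated program may leave behind numbers of \<open>t\<close> bits, so each of the \<open>l\<close> steps
  after it costs \<open>O(t)\<close>.
\<close>

lemma exec_sandwich:
  assumes before: "unit_exec A s k (overlay d S s\<^sub>0)"
    and simulated: "exec P s\<^sub>0 t p"
    and after: "unit_exec B (overlay d S p) l s'"
    and bounded: "bounded_state L s" and const: "max_const (Seq A (Seq (shift d P) B)) \<le> L"
  shows "\<exists>u\<le>(k + l) * (2 * (L + k + l) + 2) + (2 * l + 1) * t.
    exec (Seq A (Seq (shift d P) B)) s u s'"
proof -
  have const_A: "max_const A \<le> L" and const_P: "max_const P \<le> L" and const_B: "max_const B \<le> L"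
    using const by simp_all
  obtain t\<^sub>A where t\<^sub>A: "t\<^sub>A \<le> k * (2 * (L + k) + 2)" and exec_A: "exec A s t\<^sub>A (overlay d S s\<^sub>0)"
    using unit_exec_imp_exec[OF before const_A bounded order.refl] by blast
  have exec_P: "exec (shift d P) (overlay d S s\<^sub>0) t (overlay d S p)"
    using simulated by (rule exec_shift)
  have "bounded_state (L + k) (overlay d S s\<^sub>0)"
    using unit_exec_bounded_state[OF before const_A bounded] .
  then have "bounded_state (L + k + t) (overlay d S p)"
    using unit_exec_bounded_state[OF exec_imp_unit_exec[OF exec_P]] const_P by simp
  then obtain t\<^sub>B where t\<^sub>B: "t\<^sub>B \<le> l * (2 * (L + k + t + l) + 2)" and exec_B: "exec B (overlay d S p) t\<^sub>B s'"
    using unit_exec_imp_exec[OF after _ _ order.refl, of "L + k + t"] const_B by auto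
  have "t\<^sub>A + (t + t\<^sub>B) \<le> (k + l) * (2 * (L + k + l) + 2) + (2 * l + 1) * t"
    using t\<^sub>A t\<^sub>B by (simp add: algebra_simps)
  then show ?thesis
    using exec.Seq[OF exec_A exec.Seq[OF exec_P exec_B]] by blast
qed

section \<open>Cuts, cliques and hubs\<close>

definition cut_value :: "('a \<times> 'a) list \<Rightarrow> ('a \<Rightarrow> bool) \<Rightarrow> nat" where
  "cut_value es a = length (filter (\<lambda>(u, v). a u \<noteq> a v) es)"

lemma cut_value_Nil [simp]: "cut_value [] a = 0"
  by (simp add: cut_value_def)

lemma cut_value_Cons [simp]: "cut_value ((u, v) # es) a = of_bool (a u \<noteq> a v) + cut_value es a"
  by (simp add: cut_value_def)

lemma cut_value_append [simp]: "cut_value (es @ es') a = cut_value es a + cut_value es' a"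
  by (simp add: cut_value_def)

lemma cut_value_cong:
  "(\<And>u v. (u, v) \<in> set es \<Longrightarrow> a u = a' u \<and> a v = a' v) \<Longrightarrow> cut_value es a = cut_value es a'"
  unfolding cut_value_def by (intro arg_cong[where f = length] filter_cong) auto

lemma card_cut_edges:
  assumes "simple_graph V E" "edge_listing es E"
  shows "card (cut_edges V E A) = cut_value es (\<lambda>v. v \<in> A)"
proof -
  let ?pair = "\<lambda>(u, v). {u, v}" and ?cut = "filter (\<lambda>(u, v). (u \<in> A) \<noteq> (v \<in> A)) es"
  have E: "E = ?pair ` set es" and "distinct (map ?pair es)"
    using assms(2) by (auto simp: edge_listing_def)
  then have "distinct (map ?pair ?cut)"
    by (simp add: distinct_map_filter)
  moreover have "cut_edges V E A = ?pair ` set ?cut"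
  proof (intro equalityI subsetI)
    fix e assume "e \<in> cut_edges V E A"
    then obtain u v x y where edge: "(u, v) \<in> set es" "e = {u, v}" "e = {x, y}" "x \<in> A" "y \<notin> A"
      by (auto simp: cut_edges_def E)
    then have "(u, v) \<in> set ?cut"
      by (auto simp: doubleton_eq_iff)
    then show "e \<in> ?pair ` set ?cut"
      using edge(2) by (intro image_eqI[of _ _ "(u, v)"]) simp_all
  next
    fix e assume "e \<in> ?pair ` set ?cut"
    then obtain u v where edge: "(u, v) \<in> set es" "e = {u, v}" "(u \<in> A) \<noteq> (v \<in> A)"
      by auto
    then have "e \<in> E"
      by (auto simp: E)
    moreover from this have "e \<subseteq> V"
      using assms(1) by (simp add: simple_graph_def)
    then have "\<exists>x\<in>A. \<exists>y\<in>V - A. e = {x, y}"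
      using edge(2,3) by (cases "u \<in> A") auto
    ultimately show "e \<in> cut_edges V E A"
      by (simp add: cut_edges_def)
  qed
  ultimately show ?thesis
    using distinct_card[of "map ?pair ?cut"] by (simp add: cut_value_def)
qed

lemma max_cut_value_ge:
  assumes "simple_graph V E" "edge_listing es E" "is_max_cut V E A"
  shows "cut_value es a \<le> cut_value es (\<lambda>v. v \<in> A)"
proof -
  have "u \<in> V \<and> v \<in> V" if "(u, v) \<in> set es" for u v
    using assms(1,2) that by (fastforce simp: simple_graph_def edge_listing_def)
  then have "cut_value es a = cut_value es (\<lambda>v. v \<in> {v \<in> V. a v})"
    by (intro cut_value_cong) auto
  also have "\<dots> = card (cut_edges V E {v \<in> V. a v})"
    by (simp only: card_cut_edges[OF assms(1,2)])
  also have "\<dots> \<le> card (cut_edges V E A)"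
    using assms(3) by (simp add: is_max_cut_def)
  finally show ?thesis
    by (simp add: card_cut_edges[OF assms(1,2)])
qed

primrec clique_edges :: "'a list \<Rightarrow> ('a \<times> 'a) list" where
  "clique_edges [] = []"
| "clique_edges (v # vs) = map (Pair v) vs @ clique_edges vs"

lemma map_clique_edges: "map (map_prod f f) (clique_edges vs) = clique_edges (map f vs)"
  by (induction vs) auto

lemma cut_value_clique_edges:
  "cut_value (clique_edges vs) a = length (filter a vs) * length (filter (\<lambda>v. \<not> a v) vs)"
proof (induction vs)
  case (Cons v vs)
  have "cut_value (map (Pair v) vs) a = length (filter (\<lambda>w. a w \<noteq> a v) vs)"
    by (induction vs) auto
  then show ?case
    using Cons.IH by auto
qed simp

lemma cut_value_clique_edges_map:
  "cut_value (clique_edges vs) a = cut_value (clique_edges (map a vs)) (\<lambda>v. v)"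
  by (simp add: cut_value_clique_edges filter_map comp_def)

lemma cut_value_clique_edges_le: "cut_value (clique_edges vs) a \<le> (length vs)\<^sup>2 div 4"
proof -
  have "4 * (p * q) \<le> (p + q)\<^sup>2" for p q :: nat
    by (cases p q rule: le_cases) (auto simp: le_iff_add power2_eq_square algebra_simps)
  from this[of "length (filter a vs)" "length (filter (\<lambda>v. \<not> a v) vs)"] show ?thesis
    unfolding cut_value_clique_edges sum_length_filter_compl by linarith
qed

lemma set_clique_edges_subset: "set (clique_edges vs) \<subseteq> set vs \<times> set (tl vs)"
proof (induction vs)
  case (Cons v vs)
  then show ?case
    by (cases vs) auto
qed simp

lemma clique_edges_less: "sorted_wrt (<) vs \<Longrightarrow> (u, v) \<in> set (clique_edges vs) \<Longrightarrow> u < v"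
  by (induction vs) auto

lemma hubI_closed_cover:
  assumes "finite Q" "Q \<subseteq> V" and cover: "V - Q \<subseteq> \<Union> \<B>"
    and closed: "\<And>B u v. B \<in> \<B> \<Longrightarrow> v \<in> B \<Longrightarrow> u \<in> V - Q \<Longrightarrow> {u, v} \<in> E \<Longrightarrow> u \<in> B"
    and card_le: "\<And>B. B \<in> \<B> \<Longrightarrow> finite B \<and> card B \<le> \<sigma>"
    and neighbours_le: "\<And>B. B \<in> \<B> \<Longrightarrow> card {q \<in> Q. \<exists>v\<in>B. {q, v} \<in> E} \<le> \<delta>"
  shows "hub \<sigma> \<delta> V E Q"
  unfolding hub_def
proof (intro conjI ballI \<open>Q \<subseteq> V\<close>)
  fix C assume "C \<in> components (V - Q) E"
  then obtain u where "u \<in> V - Q"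
    and C: "C = {(x, y). x \<in> V - Q \<and> y \<in> V - Q \<and> {x, y} \<in> E}\<^sup>* `` {u}"
    by (auto simp: components_def)
  then obtain B where B: "B \<in> \<B>" "u \<in> B"
    using cover by blast
  have "v \<in> B" if "v \<in> C" for v
  proof -
    have "(u, v) \<in> {(x, y). x \<in> V - Q \<and> y \<in> V - Q \<and> {x, y} \<in> E}\<^sup>*"
      using that C by simp
    then show ?thesis
    proof (induction rule: rtrancl_induct)
      case (step x y)
      then show ?case
        using closed[OF B(1), of x y] by (simp add: insert_commute)
    qed (rule B(2))
  qed
  then have "C \<subseteq> B"
    by blast
  then have "card C \<le> card B"
    using card_le[OF B(1)] by (intro card_mono) simp_all
  then show "card C \<le> \<sigma>"
    using card_le[OF B(1)] by simp
  have "card {q \<in> Q. \<exists>v\<in>C. {q, v} \<in> E} \<le> card {q \<in> Q. \<exists>v\<in>B. {q, v} \<in> E}"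
    using \<open>C \<subseteq> B\<close> \<open>finite Q\<close> by (intro card_mono) auto
  then show "card {q \<in> Q. \<exists>v\<in>C. {q, v} \<in> E} \<le> \<delta>"
    using neighbours_le[OF B(1)] by simp
qed

section \<open>The clause gadget\<close>

definition pad_clause :: "nat \<Rightarrow> literal list \<Rightarrow> literal list" where
  "pad_clause n c = take 3 (c @ replicate 3 (n, True))"

definition decode :: "nat \<Rightarrow> (nat \<Rightarrow> bool) \<Rightarrow> nat \<Rightarrow> bool" where
  "decode n a x \<longleftrightarrow> a x \<noteq> a n"

definition falsified :: "(nat \<Rightarrow> bool) \<Rightarrow> literal list \<Rightarrow> bool" where
  "falsified \<alpha> c \<longleftrightarrow> (\<forall>(x, b)\<in>set c. \<alpha> x \<noteq> b)"

lemma length_pad_clause [simp]: "length (pad_clause n c) = 3"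
  by (simp add: pad_clause_def)

lemma pad_clause_nth: "j < 3 \<Longrightarrow> pad_clause n c ! j = (if j < length c then c ! j else (n, True))"
  by (simp add: pad_clause_def nth_append)

lemma fst_pad_clause_nth:
  assumes "fst ` set c \<subseteq> {..<n}" "j < 3"
  shows "fst (pad_clause n c ! j) \<in> insert n (fst ` set c)" "fst (pad_clause n c ! j) \<le> n"
  using assms by (auto simp: pad_clause_nth dest!: nth_mem)

lemma set_pad_clause:
  assumes "length c \<le> 3"
  shows "set c \<subseteq> set (pad_clause n c)" "set (pad_clause n c) \<subseteq> insert (n, True) (set c)"
  using assms by (auto simp: pad_clause_def set_replicate_conv_if split: if_splits)

lemma falsified_iff_pad_clause:
  assumes "length c \<le> 3" "\<not> \<alpha> n"
  shows "falsified \<alpha> c \<longleftrightarrow> (\<forall>j<3. case pad_clause n c ! j of (x, b) \<Rightarrow> \<alpha> x \<noteq> b)"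
proof -
  have "falsified \<alpha> c \<longleftrightarrow> falsified \<alpha> (pad_clause n c)"
    using assms(2) set_pad_clause[OF assms(1), of n] unfolding falsified_def by fast
  then show ?thesis
    by (simp add: falsified_def all_set_conv_all_nth)
qed

text \<open>
  The arguments of \<open>gadget_shape\<close> are the literal vertices, the places where they are attached,
  the reference vertex and the seven vertices of the block: \<open>block (2 * j)\<close> is the port and
  \<open>block (2 * j + 1)\<close> the inner vertex of the link for the \<open>j\<close>-th literal, and \<open>block 6\<close> is free.
  The polymorphism allows the same shape to serve as a program for emitting the gadget.
\<close>

definition gadget_shape :: "(nat \<Rightarrow> 'v) \<Rightarrow> (nat \<Rightarrow> 'v) \<Rightarrow> 'v \<Rightarrow> (nat \<Rightarrow> 'v) \<Rightarrow> ('v \<times> 'v) list" where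
  "gadget_shape var attach ref block =
     map (\<lambda>j. (var j, attach j)) [0..<3] @ map (\<lambda>j. (block (2 * j), block (2 * j + 1))) [0..<3] @
     clique_edges (ref # map (\<lambda>j. block (2 * j)) [0..<4])"

lemma gadget_shape_cong:
  assumes "\<And>j. j < 3 \<Longrightarrow> var j = var' j" "\<And>j. j < 3 \<Longrightarrow> attach j = attach' j"
    and "ref = ref'" "\<And>k. k < 7 \<Longrightarrow> block k = block' k"
  shows "gadget_shape var attach ref block = gadget_shape var' attach' ref' block'"
  using assms by (auto simp: gadget_shape_def intro!: arg_cong[where f = clique_edges])

lemma map_gadget_shape:
  "map (map_prod f f) (gadget_shape var attach ref block) =
     gadget_shape (\<lambda>j. f (var j)) (\<lambda>j. f (attach j)) (f ref) (\<lambda>k. f (block k))"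
  by (simp add: gadget_shape_def map_clique_edges comp_def)

definition gadget :: "nat \<Rightarrow> nat \<Rightarrow> literal list \<Rightarrow> (nat \<times> nat) list" where
  "gadget n b c = gadget_shape (\<lambda>j. fst (pad_clause n c ! j))
     (\<lambda>j. b + 2 * j + of_bool (snd (pad_clause n c ! j))) n (\<lambda>k. b + k)"

definition gadget_clique :: "nat \<Rightarrow> nat \<Rightarrow> nat list" where
  "gadget_clique n b = n # map (\<lambda>j. b + 2 * j) [0..<4]"

definition link_value :: "(nat \<Rightarrow> bool) \<Rightarrow> literal \<Rightarrow> bool \<Rightarrow> bool \<Rightarrow> nat" where
  "link_value a l p q = of_bool (a (fst l) \<noteq> (if snd l then q else p)) + of_bool (p \<noteq> q)"

definition literal_colour :: "(nat \<Rightarrow> bool) \<Rightarrow> literal \<Rightarrow> bool" where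
  "literal_colour a l \<longleftrightarrow> a (fst l) = snd l"

lemma link_value_le: "link_value a l p q \<le> 1 + of_bool (p = literal_colour a l)"
  by (auto simp: link_value_def literal_colour_def)

lemma link_value_opposite: "link_value a l p (\<not> p) = 1 + of_bool (p = literal_colour a l)"
  by (auto simp: link_value_def literal_colour_def)

lemma cut_value_gadget:
  "cut_value (gadget n b c) a =
     (\<Sum>j<3. link_value a (pad_clause n c ! j) (a (b + 2 * j)) (a (b + 2 * j + 1))) +
     cut_value (clique_edges (gadget_clique n b)) a"
  by (simp add: gadget_def gadget_shape_def gadget_clique_def link_value_def numeral_3_eq_3 upt_rec
      lessThan_Suc)

lemma falsified_iff_literal_colour:
  assumes "length c \<le> 3"
  shows "falsified (decode n a) c \<longleftrightarrow> (\<forall>j<3. literal_colour a (pad_clause n c ! j) = a n)"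
  by (auto simp: falsified_iff_pad_clause[OF assms, where n = n] literal_colour_def decode_def
      case_prod_unfold)

lemma cut_value_gadget_clique_le_6: "cut_value (clique_edges (gadget_clique n b)) a \<le> 6"
  using cut_value_clique_edges_le[of "gadget_clique n b" a] by (simp add: gadget_clique_def)

lemma cut_value_gadget_clique_le_4:
  assumes "\<forall>j<3. a (b + 2 * j) = a n"
  shows "cut_value (clique_edges (gadget_clique n b)) a \<le> 4"
  using assms by (cases "a n"; cases "a (b + 6)"; simp add: gadget_clique_def
    cut_value_clique_edges upt_rec numeral_3_eq_3 All_less_Suc)

lemma cut_value_gadget_le:
  assumes "length c \<le> 3"
  shows "cut_value (gadget n b c) a + of_bool (falsified (decode n a) c) \<le> 12"
proof -
  define link where "link j = link_value a (pad_clause n c ! j) (a (b + 2 * j)) (a (b + 2 * j + 1))" for j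
  let ?clique = "cut_value (clique_edges (gadget_clique n b)) a"
  have link_le: "link j \<le> 2" for j
    unfolding link_def by (rule order_trans[OF link_value_le]) simp
  have links_le: "sum link {..<3} \<le> 6"
    using sum_bounded_above[of "{..<3}" link 2] link_le by simp
  consider (satisfied) "\<not> falsified (decode n a) c"
    | (ports_agree) "\<forall>j<3. a (b + 2 * j) = a n"
    | (link_loses) j where "falsified (decode n a) c" "j < 3" "a (b + 2 * j) \<noteq> a n"
    by blast
  then have "sum link {..<3} + ?clique + of_bool (falsified (decode n a) c) \<le> 12"
  proof cases
    case satisfied
    then show ?thesis
      using links_le cut_value_gadget_clique_le_6[of n b a] by simp
  next
    case ports_agree
    then have "?clique \<le> 4"
      by (rule cut_value_gadget_clique_le_4)
    then show ?thesis
      using links_le by simp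
  next
    case (link_loses j)
    then have "a (b + 2 * j) \<noteq> literal_colour a (pad_clause n c ! j)"
      using falsified_iff_literal_colour[OF assms] by blast
    then have "link j \<le> 1"
      using link_value_le[of a "pad_clause n c ! j" "a (b + 2 * j)" "a (b + 2 * j + 1)"]
      by (simp add: link_def)
    then have "link j + sum link ({..<3} - {j}) \<le> 5"
      using sum_bounded_above[of "{..<3} - {j}" link 2] link_le \<open>j < 3\<close> by simp
    then show ?thesis
      using cut_value_gadget_clique_le_6[of n b a] \<open>j < 3\<close> by (simp add: sum.remove)
  qed
  then show ?thesis
    by (simp add: cut_value_gadget link_def)
qed

lemma cut_value_gadget_opposite:
  assumes "\<And>j. j < 3 \<Longrightarrow> a (b + 2 * j + 1) \<longleftrightarrow> \<not> a (b + 2 * j)"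
  shows "cut_value (gadget n b c) a =
     (\<Sum>j<3. 1 + of_bool (a (b + 2 * j) = literal_colour a (pad_clause n c ! j))) +
     cut_value (clique_edges (gadget_clique n b)) a"
  unfolding cut_value_gadget
  by (intro arg_cong2[where f = plus] sum.cong) (simp_all only: assms lessThan_iff link_value_opposite)

lemma five_clique_cut_attained:
  fixes p :: "nat \<Rightarrow> bool"
  assumes "\<exists>j<3. p j \<noteq> r"
  shows "\<exists>h. cut_value (clique_edges (r # map p [0..<3] @ [h])) (\<lambda>v. v) = 6"
  using assms
  by (cases r; cases "p 0"; cases "p 1"; cases "p 2")
    (auto simp: ex_bool_eq less_Suc_eq numeral_eq_Suc)

text \<open>
  The optimal colouring gives every port the colour of its literal, except that one port must
  deviate from its literal if the clause is falsified.
\<close>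

definition optimal_port :: "nat \<Rightarrow> (nat \<Rightarrow> bool) \<Rightarrow> literal list \<Rightarrow> nat \<Rightarrow> bool" where
  "optimal_port n a c j \<longleftrightarrow>
     literal_colour a (pad_clause n c ! j) \<noteq> (j = 0 \<and> falsified (decode n a) c)"

lemma optimal_port_clique_attained:
  assumes "length c \<le> 3"
  shows "\<exists>h. cut_value (clique_edges (a n # map (optimal_port n a c) [0..<3] @ [h])) (\<lambda>v. v) = 6"
proof (rule five_clique_cut_attained)
  show "\<exists>j<3. optimal_port n a c j \<noteq> a n"
  proof (cases "falsified (decode n a) c")
    case True
    then have "optimal_port n a c 0 \<noteq> a n"
      using falsified_iff_literal_colour[OF assms, of n a] by (simp add: optimal_port_def)
    then show ?thesis
      by (intro exI[of _ 0]) simp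
  next
    case False
    then show ?thesis
      using falsified_iff_literal_colour[OF assms, of n a] by (auto simp: optimal_port_def)
  qed
qed

lemma cut_value_gadget_attained:
  assumes length: "length c \<le> 3" and vars: "fst ` set c \<subseteq> {..<n}"
  shows "\<exists>block. \<forall>a'. (\<forall>v\<le>n. a' v = a v) \<longrightarrow> (\<forall>k<7. a' (b + k) = block k) \<longrightarrow>
    cut_value (gadget n b c) a' + of_bool (falsified (decode n a) c) = 12"
proof -
  let ?f = "falsified (decode n a) c" and ?port = "optimal_port n a c"
  obtain h where h: "cut_value (clique_edges (a n # map ?port [0..<3] @ [h])) (\<lambda>v. v) = 6"
    using optimal_port_clique_attained[OF length] by blast
  define block where "block k \<longleftrightarrow> (if k = 6 then h else ?port (k div 2) \<noteq> odd k)" for k :: nat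
  show ?thesis
  proof (intro exI[of _ block] allI impI)
    fix a' assume hub: "\<forall>v\<le>n. a' v = a v" and block: "\<forall>k<7. a' (b + k) = block k"
    have port: "a' (b + 2 * j) = ?port j" and inner: "a' (b + 2 * j + 1) \<longleftrightarrow> \<not> a' (b + 2 * j)"
      if "j < 3" for j
      using block[rule_format, of "2 * j"] block[rule_format, of "2 * j + 1"] that
      by (simp_all add: block_def)
    have "literal_colour a' (pad_clause n c ! j) = literal_colour a (pad_clause n c ! j)" if "j < 3" for j
      using hub fst_pad_clause_nth(2)[OF vars that] by (simp add: literal_colour_def)
    then have "(\<Sum>j<3. 1 + of_bool (a' (b + 2 * j) = literal_colour a' (pad_clause n c ! j))) =
        (\<Sum>j<3::nat. 2 - of_bool (j = 0 \<and> ?f) :: nat)"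
      by (intro sum.cong) (auto simp: port optimal_port_def)
    then have links: "(\<Sum>j<3. 1 + of_bool (a' (b + 2 * j) = literal_colour a' (pad_clause n c ! j))) =
        (6 - of_bool ?f :: nat)"
      by (simp add: numeral_3_eq_3)
    have "[0..<4] = [0..<3] @ [3::nat]"
      by (simp add: eval_nat_numeral)
    then have "map a' (gadget_clique n b) = a n # map ?port [0..<3] @ [h]"
      using hub block[rule_format, of 6] by (simp add: gadget_clique_def port block_def)
    then have clique: "cut_value (clique_edges (gadget_clique n b)) a' = 6"
      by (subst cut_value_clique_edges_map) (simp only: h)
    have "cut_value (gadget n b c) a' = 6 - of_bool ?f + 6"
      using cut_value_gadget_opposite[of a' b n c, OF inner] by (simp only: links clique)
    then show "cut_value (gadget n b c) a' + of_bool ?f = 12"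
      by simp
  qed
qed

lemma gadget_edge_bounds:
  assumes "fst ` set c \<subseteq> {..<n}" "n < b" "(u, v) \<in> set (gadget n b c)"
  shows "u < v" "b \<le> v" "v < b + 7" "u \<in> insert n (fst ` set c) \<or> b \<le> u"
proof -
  let ?clique = "clique_edges (gadget_clique n b)"
  consider (literal) j where "j < 3" "u = fst (pad_clause n c ! j)"
      "v = b + 2 * j + of_bool (snd (pad_clause n c ! j))"
    | (inner) j where "j < 3" "u = b + 2 * j" "v = b + 2 * j + 1"
    | (clique) "(u, v) \<in> set ?clique"
    using assms(3) by (auto simp: gadget_def gadget_shape_def gadget_clique_def simp del: clique_edges.simps)
  then have "u < v \<and> b \<le> v \<and> v < b + 7 \<and> (u \<in> insert n (fst ` set c) \<or> b \<le> u)"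
  proof cases
    case (literal j)
    then show ?thesis
      using fst_pad_clause_nth[OF assms(1) \<open>j < 3\<close>] assms(2) by auto
  next
    case clique
    then have "u < v"
      using clique_edges_less[OF _ clique] assms(2) by (simp add: gadget_clique_def sorted_wrt_map)
    then show ?thesis
      using clique set_clique_edges_subset[of "gadget_clique n b"]
      by (auto simp: gadget_clique_def simp del: clique_edges.simps)
  qed auto
  then show "u < v" "b \<le> v" "v < b + 7" "u \<in> insert n (fst ` set c) \<or> b \<le> u"
    by auto
qed

lemma distinct_gadget:
  assumes "fst ` set c \<subseteq> {..<n}" "n < b"
  shows "distinct (gadget n b c)"
proof -
  have "fst (pad_clause n c ! j) < b \<and> (fst (pad_clause n c ! j) \<noteq> n \<or> snd (pad_clause n c ! j))"
    if "j < 3" for j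
  proof (cases "j < length c")
    case True
    then have "fst (c ! j) < n"
      using assms(1) nth_mem[OF True] by (auto simp: image_subset_iff)
    then show ?thesis
      using True that assms(2) by (simp add: pad_clause_nth)
  qed (use that assms(2) in \<open>simp add: pad_clause_nth\<close>)
  from this[of 0] this[of 1] this[of 2] show ?thesis
    using assms(2)
    by (cases "snd (pad_clause n c ! 0)"; cases "snd (pad_clause n c ! 1)";
      cases "snd (pad_clause n c ! 2)"; simp add: gadget_def gadget_shape_def eval_nat_numeral)
qed

section \<open>The graph of a formula\<close>

definition block_start :: "nat \<Rightarrow> nat \<Rightarrow> nat" where
  "block_start n i = Suc n + 7 * i"

definition block :: "nat \<Rightarrow> nat \<Rightarrow> nat set" where
  "block n i = {block_start n i..<block_start n i + 7}"

lemma mem_block_iff: "v \<in> block n i \<longleftrightarrow> n < v \<and> (v - Suc n) div 7 = i"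
  by (auto simp: block_def block_start_def)

definition cnf_edges :: "nat \<Rightarrow> literal list list \<Rightarrow> (nat \<times> nat) list" where
  "cnf_edges n cs = concat (map (\<lambda>i. gadget n (block_start n i) (cs ! i)) [0..<length cs])"

definition cnf_graph :: "nat \<Rightarrow> literal list list \<Rightarrow> nat set set" where
  "cnf_graph n cs = (\<lambda>(u, v). {u, v}) ` set (cnf_edges n cs)"

lemma cnf_edges_snoc:
  "cnf_edges n (cs @ [c]) = cnf_edges n cs @ gadget n (block_start n (length cs)) c"
  by (auto simp: cnf_edges_def nth_append intro!: arg_cong[where f = concat])

lemma cut_value_cnf_edges:
  "cut_value (cnf_edges n cs) a = (\<Sum>i<length cs. cut_value (gadget n (block_start n i) (cs ! i)) a)"
proof (induction cs rule: rev_induct)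
  case (snoc c cs)
  then show ?case
    by (simp add: cnf_edges_snoc nth_append)
qed (simp add: cnf_edges_def)

definition clause_bound :: "nat \<Rightarrow> nat" where
  "clause_bound n = 4 * (2 * n + 1) ^ 3"

locale cnf_instance =
  fixes n :: nat and F :: "clause set" and cs :: "literal list list"
  assumes three_cnf: "three_cnf n F" and listing: "cnf_listing cs F"
begin

definition num_vertices :: nat where
  "num_vertices = block_start n (length cs)"

lemma clause_bounds:
  assumes "c \<in> set cs"
  shows "length c \<le> 3" "fst ` set c \<subseteq> {..<n}"
proof -
  have "set c \<in> F" "distinct c"
    using assms listing by (auto simp: cnf_listing_def)
  then show "length c \<le> 3" "fst ` set c \<subseteq> {..<n}"
    using three_cnf by (auto simp: three_cnf_def distinct_card)
qed

lemma length_cnf_le: "length cs \<le> clause_bound n"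
proof -
  let ?A = "{..<n} \<times> (UNIV :: bool set)"
  have "length cs = card (set ` set cs)"
    using listing distinct_card[of "map set cs"] by (simp add: cnf_listing_def)
  also have "\<dots> \<le> card (set cs)"
    by (rule card_image_le) simp
  also have "\<dots> \<le> card {c. set c \<subseteq> ?A \<and> length c \<le> 3}"
    using clause_bounds by (intro card_mono finite_lists_length_le) fastforce+
  also have "\<dots> = (\<Sum>i\<le>3. (2 * n) ^ i)"
    by (subst card_lists_length_le) (auto simp: card_cartesian_product mult.commute)
  also have "\<dots> \<le> (\<Sum>i\<le>(3::nat). (2 * n + 1) ^ 3)"
  proof (rule sum_mono)
    fix i :: nat assume "i \<in> {..3}"
    then show "(2 * n) ^ i \<le> (2 * n + 1) ^ 3"
      using power_mono[of "2 * n" "2 * n + 1" i] power_increasing[of i 3 "2 * n + 1"] by simp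
  qed
  finally show ?thesis
    by (simp add: clause_bound_def)
qed

lemma cnf_edge_in_block:
  assumes "(u, v) \<in> set (cnf_edges n cs)"
  obtains i where "i < length cs" "u < v" "v \<in> block n i" "u \<in> insert n (fst ` set (cs ! i)) \<union> block n i"
proof -
  obtain i where gadget: "i < length cs" "(u, v) \<in> set (gadget n (block_start n i) (cs ! i))"
    using assms by (auto simp: cnf_edges_def)
  have "n < block_start n i"
    by (simp add: block_start_def)
  then show ?thesis
    using that[OF gadget(1)] gadget_edge_bounds[OF clause_bounds(2)[OF nth_mem[OF gadget(1)]] _ gadget(2)]
    by (auto simp: block_def)
qed

lemma cnf_edge_bounds:
  assumes "(u, v) \<in> set (cnf_edges n cs)"
  shows "u < v" "v < num_vertices"
proof -
  obtain i where "i < length cs" "u < v" "v \<in> block n i"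
    using assms by (rule cnf_edge_in_block)
  then show "u < v" "v < num_vertices"
    by (auto simp: num_vertices_def block_def block_start_def)
qed

lemma distinct_cnf_edges: "distinct (cnf_edges n cs)"
proof -
  let ?gadget = "\<lambda>i. gadget n (block_start n i) (cs ! i)"
  have "distinct (concat (map ?gadget [0..<m]))" if "m \<le> length cs" for m
    using that
  proof (induction m)
    case (Suc m)
    have vars: "fst ` set (cs ! i) \<subseteq> {..<n}" "n < block_start n i" if "i \<le> m" for i
      using that Suc.prems clause_bounds(2) by (simp_all add: block_start_def)
    have "e \<notin> set (?gadget m)" if "i < m" "e \<in> set (?gadget i)" for i e
    proof -
      have "snd e < block_start n i + 7"
        using gadget_edge_bounds(3)[OF vars[of i], of "fst e" "snd e"] that by simp
      also have "\<dots> \<le> block_start n m"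
        using that(1) by (simp add: block_start_def)
      finally show ?thesis
        using gadget_edge_bounds(2)[OF vars[of m], of "fst e" "snd e"] by auto
    qed
    then show ?case
      using Suc distinct_gadget[OF vars[of m]] by fastforce
  qed simp
  then show ?thesis
    by (simp add: cnf_edges_def)
qed

lemma edge_listing_cnf_graph: "edge_listing (cnf_edges n cs) (cnf_graph n cs)"
proof -
  have "inj_on (\<lambda>(u, v). {u, v}) (set (cnf_edges n cs))"
    by (rule inj_onI) (fastforce simp: doubleton_eq_iff dest: cnf_edge_bounds(1))
  then show ?thesis
    using distinct_cnf_edges by (simp add: edge_listing_def cnf_graph_def distinct_map)
qed

lemma simple_cnf_graph: "simple_graph {..<num_vertices} (cnf_graph n cs)"
proof -
  have "{u, v} \<subseteq> {..<num_vertices} \<and> card {u, v} = 2" if "(u, v) \<in> set (cnf_edges n cs)" for u v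
    using cnf_edge_bounds[OF that] by auto
  then show ?thesis
    by (auto simp: simple_graph_def cnf_graph_def)
qed

lemma clause_vars_le: "i < length cs \<Longrightarrow> u \<in> insert n (fst ` set (cs ! i)) \<Longrightarrow> u \<le> n"
  using clause_bounds(2)[of "cs ! i"] by (auto simp: image_subset_iff intro: less_imp_le)

lemma cnf_graph_neighbour:
  assumes "{u, v} \<in> cnf_graph n cs" "v \<in> block n i"
  shows "i < length cs" "u \<in> insert n (fst ` set (cs ! i)) \<union> block n i"
proof -
  obtain x y where edge: "(x, y) \<in> set (cnf_edges n cs)" "{u, v} = {x, y}"
    using assms(1) by (auto simp: cnf_graph_def)
  then obtain j where in_block: "j < length cs" "y \<in> block n j" "x \<in> insert n (fst ` set (cs ! j)) \<union> block n j"
    using cnf_edge_in_block by metis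
  have "x \<in> block n j" if "n < x"
    using in_block(3) clause_vars_le[OF in_block(1), of x] that by auto
  then have "v \<in> block n j"
    using edge(2) in_block(2) assms(2) by (auto simp: doubleton_eq_iff mem_block_iff)
  then have "i = j"
    using assms(2) by (simp add: mem_block_iff)
  then show "i < length cs" "u \<in> insert n (fst ` set (cs ! i)) \<union> block n i"
    using edge(2) in_block by (auto simp: doubleton_eq_iff)
qed

lemma card_block_neighbours_le:
  assumes "i < length cs"
  shows "card {q \<in> {..<Suc n}. \<exists>v\<in>block n i. {q, v} \<in> cnf_graph n cs} \<le> 4"
proof -
  have "{q \<in> {..<Suc n}. \<exists>v\<in>block n i. {q, v} \<in> cnf_graph n cs} \<subseteq> insert n (fst ` set (cs ! i))"
    using cnf_graph_neighbour(2) by (fastforce simp: mem_block_iff)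
  then have "card {q \<in> {..<Suc n}. \<exists>v\<in>block n i. {q, v} \<in> cnf_graph n cs} \<le>
      card (insert n (fst ` set (cs ! i)))"
    by (intro card_mono) auto
  also have "\<dots> \<le> Suc (length (cs ! i))"
    using card_insert_le_m1[of "Suc (length (cs ! i))" "fst ` set (cs ! i)"]
      card_length[of "map fst (cs ! i)"] by simp
  also have "\<dots> \<le> 4"
    using clause_bounds(1)[OF nth_mem[OF assms]] by simp
  finally show ?thesis .
qed

lemma hub_cnf_graph: "hub 7 4 {..<num_vertices} (cnf_graph n cs) {..<Suc n}"
proof (rule hubI_closed_cover[where \<B> = "block n ` {..<length cs}"])
  show "{..<num_vertices} - {..<Suc n} \<subseteq> \<Union> (block n ` {..<length cs})"
    by (auto simp: num_vertices_def mem_block_iff block_start_def)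
next
  fix B u v
  assume "B \<in> block n ` {..<length cs}" "v \<in> B" "u \<in> {..<num_vertices} - {..<Suc n}"
    "{u, v} \<in> cnf_graph n cs"
  then show "u \<in> B"
    using cnf_graph_neighbour[of u v] clause_vars_le[of _ u] by fastforce
next
  fix B assume "B \<in> block n ` {..<length cs}"
  then show "finite B \<and> card B \<le> 7"
    and "card {q \<in> {..<Suc n}. \<exists>v\<in>B. {q, v} \<in> cnf_graph n cs} \<le> 4"
    using card_block_neighbours_le by (auto simp: block_def)
qed (auto simp: num_vertices_def block_start_def)

lemma card_violated: "card (violated F \<alpha>) = (\<Sum>i<length cs. of_bool (falsified \<alpha> (cs ! i)))"
proof -
  have F: "F = set ` set cs" and distinct: "distinct (map set cs)"
    using listing by (auto simp: cnf_listing_def)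
  have "violated F \<alpha> = set (map set (filter (falsified \<alpha>) cs))"
    by (auto simp: violated_def F falsified_def)
  then have "card (violated F \<alpha>) = length (filter (falsified \<alpha>) cs)"
    using distinct_card[OF distinct_map_filter[OF distinct, of "falsified \<alpha>"]] by simp
  then show ?thesis
    by (simp add: length_filter_conv_card Collect_conj_eq lessThan_def)
qed

lemma card_violated_cong:
  assumes "\<And>x. x < n \<Longrightarrow> \<alpha> x = \<beta> x"
  shows "card (violated F \<alpha>) = card (violated F \<beta>)"
proof -
  have "falsified \<alpha> (cs ! i) = falsified \<beta> (cs ! i)" if "i < length cs" for i
    using assms clause_bounds(2)[OF nth_mem[OF that]] by (force simp: falsified_def)
  then show ?thesis
    by (simp add: card_violated)
qed

lemma cut_value_cnf_edges_le:
  "cut_value (cnf_edges n cs) a + card (violated F (decode n a)) \<le> 12 * length cs"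
proof -
  have "cut_value (cnf_edges n cs) a + card (violated F (decode n a)) =
      (\<Sum>i<length cs. cut_value (gadget n (block_start n i) (cs ! i)) a +
        of_bool (falsified (decode n a) (cs ! i)))"
    by (simp add: cut_value_cnf_edges card_violated sum.distrib)
  also have "\<dots> \<le> (\<Sum>i<length cs. 12)"
    using clause_bounds(1) by (intro sum_mono cut_value_gadget_le) auto
  finally show ?thesis
    by simp
qed

lemma cut_value_cnf_edges_attained:
  "\<exists>a. cut_value (cnf_edges n cs) a + card (violated F \<alpha>) = 12 * length cs"
proof -
  define a where "a x \<longleftrightarrow> x \<noteq> n \<and> \<alpha> x" for x
  have "\<exists>g. \<forall>a'. (\<forall>v\<le>n. a' v = a v) \<longrightarrow> (\<forall>k<7. a' (block_start n i + k) = g k) \<longrightarrow>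
      cut_value (gadget n (block_start n i) (cs ! i)) a' +
        of_bool (falsified (decode n a) (cs ! i)) = 12" if "i < length cs" for i
    using clause_bounds nth_mem[OF that] by (intro cut_value_gadget_attained) auto
  then obtain g where g: "\<And>i a'. i < length cs \<Longrightarrow> \<forall>v\<le>n. a' v = a v \<Longrightarrow>
      \<forall>k<7. a' (block_start n i + k) = g i k \<Longrightarrow>
      cut_value (gadget n (block_start n i) (cs ! i)) a' +
        of_bool (falsified (decode n a) (cs ! i)) = 12"
    by metis
  define a' where "a' v = (if v \<le> n then a v else g ((v - Suc n) div 7) ((v - Suc n) mod 7))" for v
  have "a' (block_start n i + k) = g i k" if "k < 7" for i k
    using that by (simp add: a'_def block_start_def)
  then have "cut_value (gadget n (block_start n i) (cs ! i)) a' +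
      of_bool (falsified (decode n a) (cs ! i)) = 12" if "i < length cs" for i
    using that by (intro g) (auto simp: a'_def)
  then have "cut_value (cnf_edges n cs) a' + card (violated F (decode n a)) = 12 * length cs"
    unfolding cut_value_cnf_edges card_violated sum.distrib[symmetric] by simp
  moreover have "card (violated F (decode n a)) = card (violated F \<alpha>)"
    by (rule card_violated_cong) (simp add: a_def decode_def)
  ultimately show ?thesis
    by auto
qed

lemma max_cut_imp_max_sat_optimal:
  assumes A: "is_max_cut {..<num_vertices} (cnf_graph n cs) A"
    and \<alpha>: "\<And>x. x < n \<Longrightarrow> \<alpha> x \<longleftrightarrow> (x \<in> A) \<noteq> (n \<in> A)"
  shows "max_sat_optimal F \<alpha>"
  unfolding max_sat_optimal_def
proof
  fix \<beta>
  let ?cut = "cut_value (cnf_edges n cs)"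
  obtain a where a: "?cut a + card (violated F \<beta>) = 12 * length cs"
    using cut_value_cnf_edges_attained by blast
  have "?cut a \<le> ?cut (\<lambda>v. v \<in> A)"
    using simple_cnf_graph edge_listing_cnf_graph A by (rule max_cut_value_ge)
  moreover have "card (violated F \<alpha>) = card (violated F (decode n (\<lambda>v. v \<in> A)))"
    using \<alpha> by (intro card_violated_cong) (simp add: decode_def)
  ultimately show "card (violated F \<alpha>) \<le> card (violated F \<beta>)"
    using a cut_value_cnf_edges_le[of "\<lambda>v. v \<in> A"] by linarith
qed

end

section \<open>Computing the graph\<close>

definition array_of :: "nat list \<Rightarrow> nat \<Rightarrow> nat" where
  "array_of w i = (if i < length w then w ! i else 0)"

lemma array_of_Cons_0 [simp]: "array_of (x # w) 0 = x"
  by (simp add: array_of_def)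

lemma array_of_Cons_Suc [simp]: "array_of (x # w) (Suc i) = array_of w i"
  by (simp add: array_of_def)

lemma array_of_Cons_numeral [simp]: "array_of (x # w) (numeral k) = array_of w (pred_numeral k)"
  by (simp add: numeral_eq_Suc)

lemma array_of_append [simp]: "length v \<le> i \<Longrightarrow> array_of (v @ w) i = array_of w (i - length v)"
  by (auto simp: array_of_def nth_append)

lemma array_of_snoc: "(array_of w)(length w := k) = array_of (w @ [k])"
  by (auto simp: array_of_def nth_append fun_eq_iff)

lemma array_of_header:
  "(array_of (x # y # z # w))(0 := x', 1 := y', 2 := z') = array_of (x' # y' # z' # w)"
  by (auto simp: array_of_def fun_eq_iff nth_Cons split: nat.splits)

lemma input_state_array_of:
  "input_state w = \<lparr>regs = (\<lambda>x. 0)(0 := length w), arrs = (\<lambda>a i. 0)(0 := array_of w)\<rparr>"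
  by (simp add: input_state_def array_of_def[abs_def])

text \<open>
  The simulated program is shifted by 20, so its input is array 20 and its output is array 21.
\<close>

abbreviation (input) "rT \<equiv> 0 :: nat"
abbreviation (input) "rN \<equiv> 1 :: nat"
abbreviation (input) "rM \<equiv> 2 :: nat"
abbreviation (input) "rIn \<equiv> 3 :: nat"
abbreviation (input) "rOut \<equiv> 4 :: nat"
abbreviation (input) "rBase \<equiv> 5 :: nat"
abbreviation (input) "rOne \<equiv> 6 :: nat"
abbreviation (input) "rLen \<equiv> 7 :: nat"
abbreviation (input) "rEdges \<equiv> 8 :: nat"
abbreviation (input) "rRef \<equiv> 9 :: nat"
abbreviation (input) "rVar j \<equiv> 10 + j :: nat"
abbreviation (input) "rPort j \<equiv> 14 + j :: nat"

primrec seq :: "com list \<Rightarrow> com" where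
  "seq [] = Skip"
| "seq (P # Ps) = Seq P (seq Ps)"

lemma loop_free_seq [simp]: "loop_free (seq Ps) \<longleftrightarrow> list_all loop_free Ps"
  by (induction Ps) auto

lemma assigned_regs_seq [simp]: "assigned_regs (seq Ps) = \<Union> (assigned_regs ` set Ps)"
  by (induction Ps) auto

lemma assigned_arrs_seq [simp]: "assigned_arrs (seq Ps) = \<Union> (assigned_arrs ` set Ps)"
  by (induction Ps) auto

definition written :: "nat list \<Rightarrow> state \<Rightarrow> bool" where
  "written w s \<longleftrightarrow> arrs s 20 = array_of w \<and> regs s rOut = length w"

definition emit :: "reg \<times> nat \<Rightarrow> com" where
  "emit = (\<lambda>(r, k). seq [Const rT k, Add rT r rT, Store 20 rOut rT, Add rOut rOut rOne])"

lemma emit_simps [simp]: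
  "loop_free (emit e)" "assigned_regs (emit e) = {rT, rOut}" "assigned_arrs (emit e) = {20}"
  by (auto simp: emit_def split: prod.split)

lemma written_emit:
  assumes "regs s rOne = 1" "written w s" "r \<noteq> rT"
  shows "written (w @ [regs s r + k]) (apply_com (emit (r, k)) s)"
  using assms by (auto simp: written_def emit_def array_of_snoc)

lemma written_emits:
  assumes "regs s rOne = 1" "written w s" "\<forall>(r, k)\<in>set L. r \<notin> {rT, rOut}"
  shows "written (w @ map (\<lambda>(r, k). regs s r + k) L) (apply_com (seq (map emit L)) s)"
  using assms
proof (induction L arbitrary: s w)
  case (Cons e L)
  obtain r k where e: "e = (r, k)"
    by (cases e)
  let ?s = "apply_com (emit (r, k)) s"
  have regs: "regs ?s x = regs s x" if "x \<notin> {rT, rOut}" for x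
    using that by (simp add: regs_apply_com)
  have "written ((w @ [regs s r + k]) @ map (\<lambda>(r, k). regs ?s r + k) L) (apply_com (seq (map emit L)) ?s)"
    using Cons.prems by (intro Cons.IH written_emit) (auto simp: regs e)
  moreover have "map (\<lambda>(r, k). regs ?s r + k) L = map (\<lambda>(r, k). regs s r + k) L"
    using Cons.prems(3) by (auto simp: regs)
  ultimately show ?case
    by (simp add: e)
qed simp

definition flat :: "('a \<times> 'a) list \<Rightarrow> 'a list" where
  "flat es = concat (map (\<lambda>(u, v). [u, v]) es)"

lemma flat_append: "flat (es @ es') = flat es @ flat es'"
  by (simp add: flat_def)

lemma map_flat: "map f (flat es) = flat (map (map_prod f f) es)"
  by (induction es) (auto simp: flat_def)

definition gadget_code :: "((reg \<times> nat) \<times> (reg \<times> nat)) list" where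
  "gadget_code = gadget_shape (\<lambda>j. (rVar j, 0)) (\<lambda>j. (rPort j, 2 * j)) (rN, 0) (\<lambda>k. (rBase, k))"

definition read_literal :: "nat \<Rightarrow> com" where
  "read_literal j = Cond rLen
     (seq [Load (rVar j) 0 rIn, Add rIn rIn rOne, Load (rPort j) 0 rIn, Add rIn rIn rOne,
        Add (rPort j) rBase (rPort j), Sub rLen rLen rOne])
     (seq [Add (rVar j) rN rLen, Add (rPort j) rBase rOne])"

definition read_clause :: com where
  "read_clause =
     seq [Load rLen 0 rIn, Add rIn rIn rOne, read_literal 0, read_literal 1, read_literal 2]"

definition emit_gadget :: com where
  "emit_gadget = seq (map emit (flat gadget_code))"

definition next_clause :: com where
  "next_clause =
     seq [Const rT 7, Add rBase rBase rT, Const rT 16, Add rEdges rEdges rT, Sub rM rM rOne]"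

definition clause_body :: com where
  "clause_body = seq [read_clause, emit_gadget, next_clause]"

lemma assigned_by_clause_parts:
  "assigned_regs read_clause = {rLen, rIn, rVar 0, rPort 0, rVar 1, rPort 1, rVar 2, rPort 2}"
  "assigned_arrs read_clause = {}"
  "assigned_regs emit_gadget = {rT, rOut}"
  "assigned_arrs emit_gadget = {20}"
  "assigned_regs next_clause = {rT, rBase, rEdges, rM}"
  "assigned_arrs next_clause = {}"
  by (auto simp: read_clause_def read_literal_def emit_gadget_def next_clause_def flat_def
      gadget_code_def gadget_shape_def)

definition clause_loaded :: "nat \<Rightarrow> nat \<Rightarrow> literal list \<Rightarrow> state \<Rightarrow> bool" where
  "clause_loaded n b c s \<longleftrightarrow> (\<forall>j<3. regs s (rVar j) = fst (pad_clause n c ! j) \<and>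
     regs s (rPort j) = b + of_bool (snd (pad_clause n c ! j)))"

lemma regs_read_clause:
  assumes "regs s rOne = 1" "regs s rN = n" "regs s rBase = b" "length c \<le> 3"
    "arrs s 0 = array_of (v @ encode_clause c @ v')" "regs s rIn = length v"
  defines "s' \<equiv> apply_com read_clause s"
  shows "clause_loaded n b c s'"
    "regs s' rIn = length (v @ encode_clause c)"
proof -
  consider "c = []" | x y where "c = [(x, y)]" | x y x' y' where "c = [(x, y), (x', y')]"
    | x y x' y' x'' y'' where "c = [(x, y), (x', y'), (x'', y'')]"
    using assms(4) by (auto simp: numeral_3_eq_3 le_Suc_eq length_Suc_conv)
  then have "clause_loaded n b c s' \<and>
    regs s' rIn = length (v @ encode_clause c)"
    by cases (use assms(1-3,5,6) in \<open>simp_all add: clause_loaded_def s'_def read_clause_def read_literal_def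
      encode_clause_def pad_clause_def numeral_3_eq_3 All_less_Suc\<close>)
  then show "clause_loaded n b c s'"
    "regs s' rIn = length (v @ encode_clause c)"
    by auto
qed

lemma gadget_code_regs: "\<forall>(r, k)\<in>set (flat gadget_code). r \<notin> {rT, rOut}"
  by (simp add: flat_def gadget_code_def gadget_shape_def numeral_eq_Suc)

lemma map_flat_gadget_code:
  assumes "regs s rN = n" "regs s rBase = b"
    "clause_loaded n b c s"
  shows "map (\<lambda>(r, k). regs s r + k) (flat gadget_code) = flat (gadget n b c)"
  unfolding map_flat gadget_code_def map_gadget_shape gadget_def
  using assms by (intro arg_cong[where f = flat] gadget_shape_cong) (simp_all add: clause_loaded_def)

lemma written_emit_gadget:
  assumes "regs s rOne = 1" "written w s" "regs s rN = n" "regs s rBase = b"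
    "clause_loaded n b c s"
  shows "written (w @ flat (gadget n b c)) (apply_com emit_gadget s)"
  using written_emits[OF assms(1,2) gadget_code_regs] map_flat_gadget_code[OF assms(3-5)]
  by (simp add: emit_gadget_def)

definition fresh_simulation :: "state \<Rightarrow> bool" where
  "fresh_simulation s \<longleftrightarrow> (\<forall>x\<ge>20. regs s x = 0) \<and> (\<forall>a>20. arrs s a = (\<lambda>i. 0))"

lemma fresh_simulation_apply_com:
  assumes "fresh_simulation s" "assigned_regs P \<subseteq> {..<20}" "assigned_arrs P \<subseteq> {..20}"
  shows "fresh_simulation (apply_com P s)"
  unfolding fresh_simulation_def
proof (intro conjI allI impI)
  show "regs (apply_com P s) x = 0" if "20 \<le> x" for x
  proof -
    have "x \<notin> assigned_regs P"
      using assms(2) that by force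
    then show ?thesis
      using assms(1) that by (simp add: regs_apply_com fresh_simulation_def)
  qed
  show "arrs (apply_com P s) a = (\<lambda>i. 0)" if "20 < a" for a
  proof -
    have "a \<notin> assigned_arrs P"
      using assms(3) that by force
    then show ?thesis
      using assms(1) that by (simp add: arrs_apply_com fresh_simulation_def)
  qed
qed

definition clause_invariant :: "nat \<Rightarrow> literal list list \<Rightarrow> nat \<Rightarrow> state \<Rightarrow> bool" where
  "clause_invariant n cs i s \<longleftrightarrow>
     regs s rOne = 1 \<and> regs s rN = n \<and> regs s rM = length cs - i \<and> regs s rBase = block_start n i \<and>
     regs s rEdges = 16 * i \<and> arrs s 0 = array_of (encode_cnf n cs) \<and>
     regs s rIn = 2 + length (concat (map encode_clause (take i cs))) \<and>
     written ([0, 0, 0] @ flat (cnf_edges n (take i cs))) s \<and> fresh_simulation s"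

lemma clause_invariant_step:
  assumes i: "i < length cs" and "length (cs ! i) \<le> 3" and invariant: "clause_invariant n cs i s"
  shows "clause_invariant n cs (Suc i) (apply_com clause_body s)"
proof -
  define s_read where "s_read = apply_com read_clause s"
  define s_emit where "s_emit = apply_com emit_gadget s_read"
  let ?b = "block_start n i" and ?v = "[n, length cs] @ concat (map encode_clause (take i cs))"
  have take: "take (Suc i) cs = take i cs @ [cs ! i]"
    using i by (rule take_Suc_conv_app_nth)
  let ?rest = "concat (map encode_clause (drop (Suc i) cs))"
  have "encode_cnf n cs = ?v @ encode_clause (cs ! i) @ ?rest"
    by (subst id_take_nth_drop[OF i]) (use i in \<open>simp add: encode_cnf_def\<close>)
  then have input: "arrs s 0 = array_of (?v @ encode_clause (cs ! i) @ ?rest)"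
    using invariant by (simp only: clause_invariant_def)
  have regs: "regs s rOne = 1" "regs s rN = n" "regs s rBase = ?b" "regs s rIn = length ?v"
    using invariant by (simp_all add: clause_invariant_def)
  note read = regs_read_clause[OF regs(1-3) assms(2) input regs(4), folded s_read_def]
  have frame_read: "regs s_read x = regs s x"
    if "x \<notin> {rLen, rIn, rVar 0, rPort 0, rVar 1, rPort 1, rVar 2, rPort 2}" for x
    using that by (simp add: s_read_def regs_apply_com assigned_by_clause_parts)
  have frame_emit: "regs s_emit x = regs s_read x" if "x \<notin> {rT, rOut}" for x
    using that by (simp add: s_emit_def regs_apply_com assigned_by_clause_parts)
  have arrs: "arrs s_read a = arrs s a" "arrs s_emit 0 = arrs s 0" for a
    by (simp_all add: s_read_def s_emit_def arrs_apply_com assigned_by_clause_parts)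
  have "written (([0, 0, 0] @ flat (cnf_edges n (take i cs))) @ flat (gadget n ?b (cs ! i))) s_emit"
    unfolding s_emit_def using invariant read(1)
    by (intro written_emit_gadget) (simp_all add: clause_invariant_def written_def frame_read arrs)
  then have "written ([0, 0, 0] @ flat (cnf_edges n (take (Suc i) cs))) s_emit"
    using i by (simp add: take cnf_edges_snoc flat_append)
  moreover have "fresh_simulation (apply_com clause_body s)"
    using invariant by (intro fresh_simulation_apply_com)
      (auto simp: clause_invariant_def clause_body_def assigned_by_clause_parts)
  moreover have "apply_com clause_body s = apply_com next_clause s_emit"
    by (simp add: clause_body_def s_read_def s_emit_def)
  ultimately show ?thesis
    using invariant read(2) by (simp add: clause_invariant_def next_clause_def written_def take
        block_start_def encode_cnf_def frame_read frame_emit arrs)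
qed

lemma loop_free_clause_body: "loop_free clause_body"
  by (simp add: clause_body_def read_clause_def read_literal_def emit_gadget_def next_clause_def
      list_all_iff)

lemma clause_loop:
  assumes "\<forall>c\<in>set cs. length c \<le> 3" "clause_invariant n cs 0 s"
  obtains s' where "unit_exec (While rM clause_body) s (length cs * Suc (step_bound clause_body) + 1) s'"
    "clause_invariant n cs (length cs) s'"
proof (rule unit_exec_counting_loop[where I = "clause_invariant n cs", OF loop_free_clause_body assms(2)])
  show "regs s rM = length cs - i" if "clause_invariant n cs i s" for i s
    using that by (simp add: clause_invariant_def)
  show "clause_invariant n cs (Suc i) (apply_com clause_body s)"
    if "i < length cs" "clause_invariant n cs i s" for i s
    using that assms(1) by (intro clause_invariant_step) auto
qed

definition hub_listing :: "nat \<Rightarrow> nat list" where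
  "hub_listing n = map (\<lambda>j. n - j) [0..<Suc n]"

lemma distinct_hub_listing: "distinct (hub_listing n)"
  by (auto simp: hub_listing_def distinct_map inj_on_def simp del: upt_Suc)

lemma set_hub_listing: "set (hub_listing n) = {..<Suc n}"
proof -
  have "k \<in> (\<lambda>j. n - j) ` {0..<Suc n}" if "k \<le> n" for k
    using that by (intro image_eqI[of _ _ "n - k"]) auto
  then show ?thesis
    by (auto simp: hub_listing_def less_Suc_eq_le simp del: upt_Suc)
qed

definition hub_body :: com where
  "hub_body = seq [Sub rIn rIn rOne, emit (rIn, 0)]"

lemma loop_free_hub_body: "loop_free hub_body"
  by (simp add: hub_body_def)

definition hub_invariant :: "nat \<Rightarrow> nat list \<Rightarrow> nat \<Rightarrow> state \<Rightarrow> bool" where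
  "hub_invariant n w i s \<longleftrightarrow> regs s rOne = 1 \<and> regs s rN = n \<and> regs s rIn = Suc n - i \<and>
     written (w @ map (\<lambda>j. n - j) [0..<i]) s \<and> fresh_simulation s"

lemma hub_invariant_step:
  assumes "hub_invariant n w i s"
  shows "hub_invariant n w (Suc i) (apply_com hub_body s)"
proof -
  have "fresh_simulation (apply_com hub_body s)"
    using assms by (intro fresh_simulation_apply_com) (auto simp: hub_invariant_def hub_body_def)
  then show ?thesis
    using assms array_of_snoc[of "w @ map (\<lambda>j. n - j) [0..<i]" "n - i"]
    by (simp add: hub_invariant_def hub_body_def emit_def written_def)
qed

lemma hub_loop:
  assumes "hub_invariant n w 0 s"
  obtains s' where "unit_exec (While rIn hub_body) s (Suc n * Suc (step_bound hub_body) + 1) s'"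
    "hub_invariant n w (Suc n) s'"
proof (rule unit_exec_counting_loop[where I = "hub_invariant n w", OF loop_free_hub_body assms])
  show "regs s rIn = Suc n - i" if "hub_invariant n w i s" for i s
    using that by (simp add: hub_invariant_def)
  show "hub_invariant n w (Suc i) (apply_com hub_body s)" if "hub_invariant n w i s" for i s
    using that by (rule hub_invariant_step)
qed

definition read_header :: com where
  "read_header = seq [Const rOne 1, Const rT 0, Load rN 0 rT, Load rM 0 rOne, Const rIn 2,
     Add rBase rN rOne, Const rOut 3]"

definition write_header :: com where
  "write_header = seq [Const rT 0, Store 20 rT rBase, Store 20 rOne rEdges, Const rT 2,
     Add rIn rN rOne, Store 20 rT rIn]"

definition set_length :: com where
  "set_length = seq [Const rT 0, Add 20 rOut rT]"

lemma clause_invariant_read_header: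
  "clause_invariant n cs 0 (apply_com read_header (input_state (encode_cnf n cs)))"
proof -
  have "array_of [0, 0, 0] = (\<lambda>i. 0)"
    by (auto simp: array_of_def fun_eq_iff nth_Cons split: nat.splits)
  then show ?thesis
    by (simp add: clause_invariant_def read_header_def input_state_array_of encode_cnf_def
        block_start_def written_def fresh_simulation_def cnf_edges_def flat_def)
qed

lemma hub_invariant_write_header:
  assumes "clause_invariant n cs (length cs) s"
  shows "hub_invariant n
    ([block_start n (length cs), 16 * length cs, Suc n] @ flat (cnf_edges n cs)) 0 (apply_com write_header s)"
proof -
  have "fresh_simulation (apply_com write_header s)"
    using assms by (intro fresh_simulation_apply_com) (auto simp: clause_invariant_def write_header_def)
  then show ?thesis
    using assms array_of_header[of 0 0 0 "flat (cnf_edges n cs)"]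
    by (simp add: clause_invariant_def hub_invariant_def write_header_def written_def)
qed

lemma set_length_overlay:
  assumes "hub_invariant n w (Suc n) s"
  shows "apply_com set_length s = overlay 20 (apply_com set_length s) (input_state (w @ hub_listing n))"
proof (rule eq_overlayI)
  show "regs (apply_com set_length s) (20 + x) = regs (input_state (w @ hub_listing n)) x" for x
    using assms by (simp add: hub_invariant_def set_length_def written_def fresh_simulation_def
        input_state_array_of hub_listing_def)
  show "arrs (apply_com set_length s) (20 + a) = arrs (input_state (w @ hub_listing n)) a" for a
    using assms by (simp add: hub_invariant_def set_length_def written_def fresh_simulation_def
        input_state_array_of hub_listing_def)
qed

definition build_graph :: com where
  "build_graph = Seq read_header (Seq (While rM clause_body) (Seq write_header
     (Seq (While rIn hub_body) set_length)))"

definition build_steps :: "nat \<Rightarrow> nat \<Rightarrow> nat" where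
  "build_steps n m = step_bound read_header + ((m * Suc (step_bound clause_body) + 1) +
     (step_bound write_header + ((Suc n * Suc (step_bound hub_body) + 1) + step_bound set_length)))"

definition encode_cnf_graph :: "nat \<Rightarrow> literal list list \<Rightarrow> nat list" where
  "encode_cnf_graph n cs =
     encode_graph_hub (block_start n (length cs)) (cnf_edges n cs) (hub_listing n)"

lemma length_cnf_edges: "length (cnf_edges n cs) = 16 * length cs"
  by (simp add: cnf_edges_def length_concat comp_def gadget_def gadget_shape_def numeral_eq_Suc
      sum_list_triv)

lemma unit_exec_build_graph:
  assumes "\<forall>c\<in>set cs. length c \<le> 3"
  obtains S where "unit_exec build_graph (input_state (encode_cnf n cs)) (build_steps n (length cs))
      (overlay 20 S (input_state (encode_cnf_graph n cs)))"
    "regs S rOne = 1" "regs S rN = n"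
proof -
  define s\<^sub>0 where "s\<^sub>0 = input_state (encode_cnf n cs)"
  let ?w = "[block_start n (length cs), 16 * length cs, Suc n] @ flat (cnf_edges n cs)"
  obtain s\<^sub>1 where clauses: "unit_exec (While rM clause_body) (apply_com read_header s\<^sub>0)
      (length cs * Suc (step_bound clause_body) + 1) s\<^sub>1" "clause_invariant n cs (length cs) s\<^sub>1"
    using clause_loop[OF assms clause_invariant_read_header] unfolding s\<^sub>0_def .
  obtain s\<^sub>2 where hub: "unit_exec (While rIn hub_body) (apply_com write_header s\<^sub>1)
      (Suc n * Suc (step_bound hub_body) + 1) s\<^sub>2" "hub_invariant n ?w (Suc n) s\<^sub>2"
    using hub_loop[OF hub_invariant_write_header[OF clauses(2)]] .
  define S where "S = apply_com set_length s\<^sub>2"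
  have "unit_exec build_graph s\<^sub>0 (build_steps n (length cs)) S"
    unfolding build_graph_def build_steps_def S_def
    by (intro unit_exec.Seq[OF unit_exec_loop_free] unit_exec.Seq[OF clauses(1)]
        unit_exec.Seq[OF hub(1)] unit_exec_loop_free)
      (simp_all add: read_header_def write_header_def set_length_def)
  moreover have "?w @ hub_listing n = encode_cnf_graph n cs"
    by (simp add: encode_cnf_graph_def encode_graph_hub_def length_cnf_edges flat_def hub_listing_def)
  then have "S = overlay 20 S (input_state (encode_cnf_graph n cs))"
    using set_length_overlay[OF hub(2)] by (simp only: S_def)
  moreover have "regs S rOne = 1" "regs S rN = n"
    using hub(2) by (simp_all add: S_def set_length_def hub_invariant_def)
  ultimately show ?thesis
    using that[of S] by (simp add: s\<^sub>0_def)
qed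

section \<open>Reading off the assignment\<close>

definition answer_body :: com where
  "answer_body = seq [Sub rN rN rOne, Load rT 21 rN,
     Cond rRef (Cond rT (Const rT 0) (Const rT 1)) Skip, Store 1 rN rT]"

definition read_answer :: com where
  "read_answer = Seq (Load rRef 21 rN) (While rN answer_body)"

definition answer_steps :: "nat \<Rightarrow> nat" where
  "answer_steps n = 1 + (n * Suc (step_bound answer_body) + 1)"

definition answer_invariant :: "nat \<Rightarrow> (nat \<Rightarrow> nat) \<Rightarrow> nat \<Rightarrow> state \<Rightarrow> bool" where
  "answer_invariant n out i s \<longleftrightarrow>
     regs s rOne = 1 \<and> regs s rN = n - i \<and> regs s rRef = out n \<and> arrs s 21 = out \<and>
     (\<forall>x\<in>{n - i..<n}. arrs s 1 x \<noteq> 0 \<longleftrightarrow> (out x \<noteq> 0) \<noteq> (out n \<noteq> 0))"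

lemma answer_invariant_step:
  assumes "i < n" "answer_invariant n out i s"
  shows "answer_invariant n out (Suc i) (apply_com answer_body s)"
proof -
  have "{n - Suc i..<n} = insert (n - Suc i) {n - i..<n}"
    using assms(1) by auto
  then show ?thesis
    using assms by (auto simp: answer_invariant_def answer_body_def)
qed

lemma unit_exec_read_answer:
  assumes "regs s rOne = 1" "regs s rN = n"
  obtains s' where "unit_exec read_answer s (answer_steps n) s'"
    "\<And>x. x < n \<Longrightarrow> arrs s' 1 x \<noteq> 0 \<longleftrightarrow> (arrs s 21 x \<noteq> 0) \<noteq> (arrs s 21 n \<noteq> 0)"
proof -
  let ?I = "answer_invariant n (arrs s 21)" and ?t = "set_reg rRef (arrs s 21 n) s"
  have load: "unit_exec (Load rRef 21 rN) s 1 ?t"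
    using unit_exec.Load[of rRef 21 rN s] assms(2) by simp
  obtain s' where s': "unit_exec (While rN answer_body) ?t (n * Suc (step_bound answer_body) + 1) s'"
    "?I n s'"
  proof (rule unit_exec_counting_loop)
    show "loop_free answer_body"
      by (simp add: answer_body_def)
    show "?I 0 ?t"
      using assms by (simp add: answer_invariant_def)
    show "regs s rN = n - i" if "?I i s" for i s
      using that by (simp add: answer_invariant_def)
    show "?I (Suc i) (apply_com answer_body s)" if "i < n" "?I i s" for i s
      using that by (rule answer_invariant_step)
  qed
  show ?thesis
  proof (rule that)
    show "unit_exec read_answer s (answer_steps n) s'"
      unfolding read_answer_def answer_steps_def using load s'(1) by (rule unit_exec.Seq)
  qed (use s'(2) in \<open>simp add: answer_invariant_def\<close>)
qed

section \<open>Polynomial bounds\<close>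

lemma poly_boundedD:
  assumes "poly_bounded f"
  shows "\<exists>c k. \<forall>n. f n \<le> c * (n + 1) ^ k"
proof -
  obtain k where "(\<lambda>n. real (f n)) \<in> O(\<lambda>n. real n ^ k)"
    using assms by (auto simp: poly_bounded_def)
  then obtain C where C: "C > 0" "\<forall>\<^sub>F n in sequentially. norm (real (f n)) \<le> C * norm (real n ^ k)"
    by (auto elim: landau_o.bigE)
  have "\<forall>\<^sub>F n in sequentially. norm (real (f n) / real (n + 1) ^ k) \<le> C"
  proof (rule eventually_mono[OF C(2)])
    fix n assume "norm (real (f n)) \<le> C * norm (real n ^ k)"
    also have "\<dots> \<le> C * real (n + 1) ^ k"
      using C(1) by (simp add: power_mono)
    finally show "norm (real (f n) / real (n + 1) ^ k) \<le> C"
      by (simp add: divide_le_eq)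
  qed
  then have "Bseq (\<lambda>n. real (f n) / real (n + 1) ^ k)"
    by (rule BfunI)
  then obtain N where "\<forall>n. norm (real (f n) / real (n + 1) ^ k) \<le> real (Suc N)"
    by (auto simp: Bseq_iff)
  then have "real (f n) \<le> real (Suc N * (n + 1) ^ k)" for n
    by (simp add: divide_le_eq algebra_simps)
  then show ?thesis
    unfolding of_nat_le_iff by blast
qed

lemma poly_boundedI:
  assumes "\<And>n. f n \<le> c * (n + 1) ^ k"
  shows "poly_bounded f"
proof -
  have "(\<lambda>n. real (n + 1)) \<in> O(\<lambda>n. real n)"
    by (intro bigoI[of _ 2] eventually_mono[OF eventually_ge_at_top[of 1]]) auto
  then have "(\<lambda>n. real (n + 1) ^ k) \<in> O(\<lambda>n. real n ^ k)"
    by (rule landau_o.big_power)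
  moreover have "(\<lambda>n. real (f n)) \<in> O(\<lambda>n. real (n + 1) ^ k)"
  proof (intro bigoI always_eventually allI)
    fix n
    show "norm (real (f n)) \<le> real c * norm (real (n + 1) ^ k)"
      using assms[of n, folded of_nat_le_iff[where 'a = real]] by simp
  qed
  ultimately show ?thesis
    unfolding poly_bounded_def using landau_o.big_trans by blast
qed

lemma poly_bounded_const: "poly_bounded (\<lambda>n. c)"
  by (rule poly_boundedI[of _ c 0]) simp

lemma poly_bounded_id: "poly_bounded (\<lambda>n. n)"
  by (rule poly_boundedI[of _ 1 1]) simp

lemma poly_bounded_add:
  assumes "poly_bounded f" "poly_bounded g"
  shows "poly_bounded (\<lambda>n. f n + g n)"
proof -
  obtain c k where f: "\<And>n. f n \<le> c * (n + 1) ^ k"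
    using poly_boundedD[OF assms(1)] by blast
  obtain d l where g: "\<And>n. g n \<le> d * (n + 1) ^ l"
    using poly_boundedD[OF assms(2)] by blast
  show ?thesis
  proof (rule poly_boundedI)
    fix n
    have "f n \<le> c * (n + 1) ^ (k + l)"
      by (rule order_trans[OF f]) (intro mult_le_mono2 power_increasing; simp)
    moreover have "g n \<le> d * (n + 1) ^ (k + l)"
      by (rule order_trans[OF g]) (intro mult_le_mono2 power_increasing; simp)
    ultimately show "f n + g n \<le> (c + d) * (n + 1) ^ (k + l)"
      by (simp add: add_mult_distrib)
  qed
qed

lemma poly_bounded_mult:
  assumes "poly_bounded f" "poly_bounded g"
  shows "poly_bounded (\<lambda>n. f n * g n)"
proof -
  obtain c k where f: "\<And>n. f n \<le> c * (n + 1) ^ k"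
    using poly_boundedD[OF assms(1)] by blast
  obtain d l where g: "\<And>n. g n \<le> d * (n + 1) ^ l"
    using poly_boundedD[OF assms(2)] by blast
  show ?thesis
  proof (rule poly_boundedI)
    show "f n * g n \<le> (c * d) * (n + 1) ^ (k + l)" for n
      using mult_le_mono[OF f[of n] g[of n]] by (simp add: power_add ac_simps)
  qed
qed

lemma poly_bounded_Suc: "poly_bounded f \<Longrightarrow> poly_bounded (\<lambda>n. Suc (f n))"
  using poly_bounded_add[OF _ poly_bounded_const[of 1]] by simp

lemma poly_bounded_power: "poly_bounded f \<Longrightarrow> poly_bounded (\<lambda>n. f n ^ k)"
  by (induction k) (auto intro: poly_bounded_const poly_bounded_mult)

lemmas poly_bounded_intros = poly_bounded_const poly_bounded_id poly_bounded_add poly_bounded_mult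
  poly_bounded_Suc poly_bounded_power

lemma poly_bounded_mono_majorant:
  assumes "poly_bounded f"
  shows "\<exists>h. mono h \<and> (\<forall>n. f n \<le> h n) \<and> (\<forall>g. poly_bounded g \<longrightarrow> poly_bounded (\<lambda>n. h (g n)))"
proof -
  obtain c k where f: "\<And>n. f n \<le> c * (n + 1) ^ k"
    using poly_boundedD[OF assms] by blast
  show ?thesis
  proof (intro exI[of _ "\<lambda>n. c * (n + 1) ^ k"] conjI)
    show "mono (\<lambda>n. c * (n + 1) ^ k)"
      by (intro monoI mult_le_mono2 power_mono) simp_all
    show "\<forall>g. poly_bounded g \<longrightarrow> poly_bounded (\<lambda>n. c * (g n + 1) ^ k)"
      by (intro allI impI poly_bounded_intros)
  qed (use f in blast)
qed

section \<open>The reduction\<close>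

definition reduction :: "com \<Rightarrow> com" where
  "reduction P = Seq build_graph (Seq (shift 20 P) read_answer)"

definition bit_bound :: "com \<Rightarrow> nat \<Rightarrow> nat \<Rightarrow> nat" where
  "bit_bound P n m = n + 7 * m + 3 + max_const (reduction P)"

definition overhead :: "com \<Rightarrow> nat \<Rightarrow> nat \<Rightarrow> nat" where
  "overhead P n m = (let k = build_steps n m + answer_steps n in
     k * (2 * (bit_bound P n m + k) + 2))"

definition reduction_factor :: "com \<Rightarrow> (nat \<Rightarrow> nat) \<Rightarrow> nat \<Rightarrow> nat" where
  "reduction_factor P h n = overhead P n (clause_bound n) +
     (2 * answer_steps n + 1) * (2 * h (block_start n (clause_bound n)))"

lemma overhead_mono: "m \<le> m' \<Longrightarrow> overhead P n m \<le> overhead P n m'"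
  unfolding overhead_def bit_bound_def build_steps_def Let_def
  by (intro add_le_mono mult_le_mono order.refl) auto

lemma bounded_input_state:
  assumes "\<And>k. k \<in> set w \<Longrightarrow> k \<le> L" "length w \<le> L"
  shows "bounded_state L (input_state w)"
  using assms by (auto simp: bounded_state_def input_state_def intro!: less_power_if_le)

lemma length_encode_clause: "length (encode_clause c) = Suc (2 * length c)"
  by (simp add: encode_clause_def length_concat comp_def case_prod_unfold sum_list_triv)

lemma exponential_time_absorb:
  fixes a b F A B :: real
  assumes "0 \<le> a" "a \<le> b" "1 \<le> b" "b \<le> 2" "0 \<le> A" "0 \<le> B" "0 \<le> F"
  shows "A + B * (a ^ Suc n * F) \<le> b ^ n * (A + B * (2 * F))"
proof -
  have "a ^ Suc n \<le> b ^ Suc n"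
    using assms(1,2) by (rule power_mono[rotated])
  also have "\<dots> \<le> 2 * b ^ n"
    using assms(3,4) by (simp add: mult_right_mono)
  finally have "B * (a ^ Suc n * F) \<le> B * (2 * b ^ n * F)"
    using assms(6,7) by (intro mult_left_mono mult_right_mono)
  moreover have "A \<le> b ^ n * A"
    using assms(3,5) one_le_power[of b n] by (simp add: mult_le_cancel_right1)
  ultimately show ?thesis
    by (simp add: algebra_simps)
qed

context cnf_instance
begin

lemma length_encode_cnf: "length (encode_cnf n cs) \<le> 2 + 7 * length cs"
proof -
  have "length (concat (map encode_clause cs)) \<le> (\<Sum>c\<leftarrow>cs. 7)"
    unfolding length_concat map_map
    using clause_bounds(1) by (intro sum_list_mono) (fastforce simp: length_encode_clause)
  then show ?thesis
    by (simp add: encode_cnf_def sum_list_triv)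
qed

lemma encode_cnf_le:
  assumes "k \<in> set (encode_cnf n cs)"
  shows "k \<le> n + length cs + 3"
proof -
  consider (header) "k = n \<or> k = length cs" | (clause) c where "c \<in> set cs" "k \<in> set (encode_clause c)"
    using assms by (auto simp: encode_cnf_def)
  then show ?thesis
  proof cases
    case (clause c)
    then have "k \<le> 3 \<or> k < n"
      using clause_bounds[of c] by (auto simp: encode_clause_def image_subset_iff)
    then show ?thesis
      by auto
  qed auto
qed

lemma bounded_encode_cnf: "bounded_state (bit_bound P n (length cs)) (input_state (encode_cnf n cs))"
proof (rule bounded_input_state)
  show "k \<le> bit_bound P n (length cs)" if "k \<in> set (encode_cnf n cs)" for k
    using encode_cnf_le[OF that] by (simp add: bit_bound_def)
  show "length (encode_cnf n cs) \<le> bit_bound P n (length cs)"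
    using length_encode_cnf by (simp add: bit_bound_def)
qed

lemma max_cut_on_cnf_graph:
  assumes "solves_max_cut_with_hub 7 4 P T"
  obtains t p where "exec P (input_state (encode_cnf_graph n cs)) t p" "real t \<le> T num_vertices (Suc n)"
    "is_max_cut {..<num_vertices} (cnf_graph n cs) {v. v < num_vertices \<and> arrs p 1 v \<noteq> 0}"
proof -
  have "computes_within P (encode_cnf_graph n cs) (T num_vertices (card {..<Suc n}))
      (\<lambda>out. is_max_cut {..<num_vertices} (cnf_graph n cs) {v. v < num_vertices \<and> out v \<noteq> 0})"
    using assms simple_cnf_graph hub_cnf_graph edge_listing_cnf_graph distinct_hub_listing set_hub_listing
    unfolding solves_max_cut_with_hub_def encode_cnf_graph_def num_vertices_def by blast
  then show ?thesis
    using that by (auto simp: computes_within_def)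
qed

lemma exec_reduction:
  assumes "solves_max_cut_with_hub 7 4 P T"
  shows "\<exists>t s t'. exec (reduction P) (input_state (encode_cnf n cs)) t s \<and>
    real t' \<le> T num_vertices (Suc n) \<and> t \<le> overhead P n (length cs) + (2 * answer_steps n + 1) * t' \<and>
    max_sat_optimal F (\<lambda>x. arrs s 1 x \<noteq> 0)"
proof -
  obtain t' p where simulated: "exec P (input_state (encode_cnf_graph n cs)) t' p"
      "real t' \<le> T num_vertices (Suc n)"
    and max_cut: "is_max_cut {..<num_vertices} (cnf_graph n cs) {v. v < num_vertices \<and> arrs p 1 v \<noteq> 0}"
    using max_cut_on_cnf_graph[OF assms] .
  obtain S where build: "unit_exec build_graph (input_state (encode_cnf n cs))
      (build_steps n (length cs)) (overlay 20 S (input_state (encode_cnf_graph n cs)))"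
    and S: "regs S rOne = 1" "regs S rN = n"
    using unit_exec_build_graph clause_bounds(1) by metis
  obtain s where answer: "unit_exec read_answer (overlay 20 S p) (answer_steps n) s"
    "\<And>x. x < n \<Longrightarrow> arrs s 1 x \<noteq> 0 \<longleftrightarrow> (arrs p 1 x \<noteq> 0) \<noteq> (arrs p 1 n \<noteq> 0)"
    using unit_exec_read_answer[of "overlay 20 S p" n] S by (auto simp: regs_overlay arrs_overlay)
  have "max_const (reduction P) \<le> bit_bound P n (length cs)"
    by (simp add: bit_bound_def)
  then obtain t where "t \<le> overhead P n (length cs) + (2 * answer_steps n + 1) * t'"
    "exec (reduction P) (input_state (encode_cnf n cs)) t s"
    using exec_sandwich[OF build simulated(1) answer(1) bounded_encode_cnf, folded reduction_def]
    unfolding overhead_def Let_def by (auto simp only: add.assoc)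
  moreover have "max_sat_optimal F (\<lambda>x. arrs s 1 x \<noteq> 0)"
    using max_cut
    by (rule max_cut_imp_max_sat_optimal) (use answer(2) in \<open>simp add: num_vertices_def block_start_def\<close>)
  ultimately show ?thesis
    using simulated(2) by blast
qed

lemma reduction_computes_max_sat:
  assumes \<epsilon>: "0 < \<epsilon>" "\<epsilon> < 2" and h: "mono h" "\<And>n. f n \<le> h n"
    and P: "solves_max_cut_with_hub 7 4 P (\<lambda>n p. (2 - \<epsilon>) ^ p * real (f n))"
  shows "computes_within (reduction P) (encode_cnf n cs)
    ((2 - min \<epsilon> 1) ^ n * real (reduction_factor P h n)) (\<lambda>out. max_sat_optimal F (\<lambda>x. out x \<noteq> 0))"
proof -
  let ?A = "overhead P n (clause_bound n)" and ?B = "2 * answer_steps n + 1"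
    and ?h = "h (block_start n (clause_bound n))"
  obtain t s t' where exec: "exec (reduction P) (input_state (encode_cnf n cs)) t s"
    and max_cut_time: "real t' \<le> (2 - \<epsilon>) ^ Suc n * real (f num_vertices)"
    and time: "t \<le> overhead P n (length cs) + ?B * t'"
    and optimal: "max_sat_optimal F (\<lambda>x. arrs s 1 x \<noteq> 0)"
    using exec_reduction[OF P] by blast
  have "f num_vertices \<le> ?h"
    using h(2)[of num_vertices] monoD[OF h(1), of num_vertices "block_start n (clause_bound n)"] length_cnf_le
    by (simp add: num_vertices_def block_start_def)
  then have "(2 - \<epsilon>) ^ Suc n * real (f num_vertices) \<le> (2 - \<epsilon>) ^ Suc n * real ?h"
    using \<epsilon>(2) by (intro mult_left_mono) auto
  then have t': "real t' \<le> (2 - \<epsilon>) ^ Suc n * real ?h"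
    using max_cut_time by linarith
  have "real t \<le> real (?A + ?B * t')"
    using time overhead_mono[OF length_cnf_le, of P n] unfolding of_nat_le_iff by linarith
  also have "\<dots> = real ?A + real ?B * real t'"
    by (simp only: of_nat_add of_nat_mult)
  also have "\<dots> \<le> real ?A + real ?B * ((2 - \<epsilon>) ^ Suc n * real ?h)"
    using t' by (intro add_left_mono mult_left_mono) simp_all
  also have "\<dots> \<le> (2 - min \<epsilon> 1) ^ n * (real ?A + real ?B * (2 * real ?h))"
    using \<epsilon> by (intro exponential_time_absorb) auto
  also have "\<dots> = (2 - min \<epsilon> 1) ^ n * real (reduction_factor P h n)"
    unfolding reduction_factor_def by (simp only: of_nat_add of_nat_mult of_nat_numeral)
  finally show ?thesis
    using exec optimal unfolding computes_within_def by blast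
qed

end

lemma reduction_solves_max_3sat:
  assumes \<epsilon>: "0 < \<epsilon>" "\<epsilon> < 2" and f: "poly_bounded f"
    and P: "solves_max_cut_with_hub 7 4 P (\<lambda>n p. (2 - \<epsilon>) ^ p * real (f n))"
  shows "\<exists>g. poly_bounded g \<and> solves_max_3sat (reduction P) (\<lambda>n. (2 - min \<epsilon> 1) ^ n * real (g n))"
proof -
  obtain h where h: "mono h" "\<And>n. f n \<le> h n"
    and h_comp: "\<And>g. poly_bounded g \<Longrightarrow> poly_bounded (\<lambda>n. h (g n))"
    using poly_bounded_mono_majorant[OF f] by blast
  have "poly_bounded (reduction_factor P h)"
    unfolding reduction_factor_def[abs_def] overhead_def bit_bound_def Let_def build_steps_def answer_steps_def
      clause_bound_def block_start_def
    by (intro poly_bounded_intros h_comp)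
  moreover have "solves_max_3sat (reduction P) (\<lambda>n. (2 - min \<epsilon> 1) ^ n * real (reduction_factor P h n))"
    unfolding solves_max_3sat_def
  proof (intro allI impI, elim conjE)
    fix n F cs
    assume "three_cnf n F" "cnf_listing cs F"
    then interpret cnf_instance n F cs
      by unfold_locales
    show "computes_within (reduction P) (encode_cnf n cs)
        ((2 - min \<epsilon> 1) ^ n * real (reduction_factor P h n)) (\<lambda>out. max_sat_optimal F (\<lambda>x. out x \<noteq> 0))"
      using \<epsilon> h P by (rule reduction_computes_max_sat)
  qed
  ultimately show ?thesis
    by blast
qed

lemma solves_max_cut_time_pos:
  assumes "solves_max_cut_with_hub \<sigma> \<delta> P T"
  shows "0 < T 1 1"
proof -
  have "hub \<sigma> \<delta> {..<1} {} {0::nat}" "simple_graph {..<1::nat} {}"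
    by (auto simp: hub_def components_def simple_graph_def)
  moreover have "edge_listing [] {}"
    by (simp add: edge_listing_def)
  ultimately have "computes_within P (encode_graph_hub 1 [] [0]) (T 1 (card {0::nat}))
      (\<lambda>out. is_max_cut {..<1} {} {v. v < 1 \<and> out v \<noteq> 0})"
    using assms[unfolded solves_max_cut_with_hub_def, rule_format, of 1 "{}" "{0}" "[]" "[0]"] by simp
  then obtain t s where t: "exec P (input_state (encode_graph_hub 1 [] [0])) t s" "real t \<le> T 1 1"
    by (auto simp: computes_within_def)
  then show ?thesis
    using exec_time_pos[OF t(1)] by linarith
qed

theorem theorem6p2:
  "\<exists>\<sigma>::nat. \<forall>\<epsilon>::real. \<epsilon> > 0 \<longrightarrow> M3SH \<longrightarrow>
     \<not> (\<exists>P f. poly_bounded f \<and>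
          solves_max_cut_with_hub \<sigma> 4 P (\<lambda>n p. (2 - \<epsilon>) ^ p * real (f n)))"
proof (intro exI[of _ 7] allI impI notI, elim exE conjE)
  fix \<epsilon> :: real and P f
  assume "\<epsilon> > 0" M3SH and f: "poly_bounded f"
    and P: "solves_max_cut_with_hub 7 4 P (\<lambda>n p. (2 - \<epsilon>) ^ p * real (f n))"
  have "\<epsilon> < 2"
    using solves_max_cut_time_pos[OF P] by (simp add: zero_less_mult_iff)
  then obtain g where "poly_bounded g"
    "solves_max_3sat (reduction P) (\<lambda>n. (2 - min \<epsilon> 1) ^ n * real (g n))"
    using reduction_solves_max_3sat[OF \<open>\<epsilon> > 0\<close> _ f P] by blast
  moreover have "min \<epsilon> 1 > 0"
    using \<open>\<epsilon> > 0\<close> by simp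
  ultimately show False
    using \<open>M3SH\<close> unfolding M3SH_def by blast
qed

end
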